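(* Let $n\in\mathbb{N}$ with $n\ge 3$ and let $G=K_{3,n}$ be the complete bipartite graph with partite sets of sizes $3$ and $n$. Then the following statements hold. (i) $\epsilon_\ell(G,t)=1/2$ for every integer $t\ge 4$. (ii) $\epsilon_\ell(G,3)=1/2$ when $n=3$. (iii) $1/3\le\epsilon_\ell(G,3)\le 1/2$ whenever $4\le n\le 6$. (iv) $\epsilon_\ell(G,3)=1/3$ whenever $7\le n\le 8$. (v) $\epsilon_\ell(G,3)=0$ whenever $9\le n\le 26$.
   Context: All graphs are nonempty, finite and simple; $\mathbb{N}=\{1,2,3,\ldots\}$. A list assignment $L$ for a graph $G$ assigns to each vertex $v$ a set $L(v)$ of colors; it is a $k$-assignment if $|L(v)|=k$ for every $v\in V(G)$. A proper $L$-coloring of $G$ is a proper coloring $f$ of $G$ with $f(v)\in L(v)$ for every $v\in V(G)$. The list chromatic number $\chi_\ell(G)$ is the smallest $k$ such that $G$ has a proper $L$-coloring for every $k$-assignment $L$ for $G$. A request of $L$ is a function $r$ with nonempty domain $D\subseteq V(G)$ such that $r(v)\in L(v)$ for each $v\in D$. For $\epsilon\in[0,1]$, the triple $(G,L,r)$ is $\epsilon$-satisfiable if there is a proper $L$-coloring $f$ of $G$ with $f(v)=r(v)$ for at least $\epsilon|D|$ vertices $v\in D$. The graph $G$ is $(k,\epsilon)$-flexible if $(G,L,r)$ is $\epsilon$-satisfiable for every $k$-assignment $L$ for $G$ and every request $r$ of $L$. The list epsilon flexibility function of $G$ maps each integer $t\ge\chi_\ell(G)$ to $\epsilon_\ell(G,t)$,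 the largest $\epsilon\in[0,1]$ such that $G$ is $(t,\epsilon)$-flexible. (It is known that $\chi_\ell(K_{3,n})\le 3$ if and only if $n\le 26$, and that $\chi_\ell(K_{3,n})\le 4$ for all $n$, so all quantities in the statement are defined.) *)

theory Defs
  imports Complex_Main "Graph_Theory.Graph_Theory"
begin

text \<open>
  Finite simple graphs are the symmetric loop-free digraphs without multiple arcs of the
  locale \<^locale>\<open>graph\<close>, so an edge \<open>uv\<close> is the pair of arcs \<open>(u, v)\<close>, \<open>(v, u)\<close> in
  \<open>arcs_ends G\<close>. Colors are natural numbers; as only finitely many colors occur in the lists
  of a finite graph, this is no restriction. List assignments and colorings are total functions
  whose values outside \<open>verts G\<close> are irrelevant; a request is a partial function.
\<close>

definition list_assignment :: "('a, 'b) pre_digraph \<Rightarrow> nat \<Rightarrow> ('a \<Rightarrow> nat set) \<Rightarrow> bool" where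
  "list_assignment G k L \<longleftrightarrow> (\<forall>v \<in> verts G. finite (L v) \<and> card (L v) = k)"

definition proper_list_coloring ::
    "('a, 'b) pre_digraph \<Rightarrow> ('a \<Rightarrow> nat set) \<Rightarrow> ('a \<Rightarrow> nat) \<Rightarrow> bool" where
  "proper_list_coloring G L f \<longleftrightarrow>
     (\<forall>v \<in> verts G. f v \<in> L v) \<and> (\<forall>(u, v) \<in> arcs_ends G. f u \<noteq> f v)"

definition list_chromatic_number :: "('a, 'b) pre_digraph \<Rightarrow> nat" where
  "list_chromatic_number G =
     (LEAST k. \<forall>L. list_assignment G k L \<longrightarrow> (\<exists>f. proper_list_coloring G L f))"

definition list_request ::
    "('a, 'b) pre_digraph \<Rightarrow> ('a \<Rightarrow> nat set) \<Rightarrow> ('a \<rightharpoonup> nat) \<Rightarrow> bool" where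
  "list_request G L r \<longleftrightarrow>
     dom r \<noteq> {} \<and> dom r \<subseteq> verts G \<and> (\<forall>v \<in> dom r. the (r v) \<in> L v)"

definition satisfiable_request ::
    "real \<Rightarrow> ('a, 'b) pre_digraph \<Rightarrow> ('a \<Rightarrow> nat set) \<Rightarrow> ('a \<rightharpoonup> nat) \<Rightarrow> bool" where
  "satisfiable_request \<epsilon> G L r \<longleftrightarrow>
     (\<exists>f. proper_list_coloring G L f \<and>
          \<epsilon> * real (card (dom r)) \<le> real (card {v \<in> dom r. r v = Some (f v)}))"

definition flexible :: "('a, 'b) pre_digraph \<Rightarrow> nat \<Rightarrow> real \<Rightarrow> bool" where
  "flexible G k \<epsilon> \<longleftrightarrow>
     (\<forall>L r. list_assignment G k L \<longrightarrow> list_request G L r \<longrightarrow> satisfiable_request \<epsilon> G L r)"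

text \<open>
  The list epsilon flexibility function has domain \<open>{t. list_chromatic_number G \<le> t}\<close>; its value
  elsewhere is left unspecified.
\<close>

definition list_epsilon_flexibility :: "('a, 'b) pre_digraph \<Rightarrow> nat \<Rightarrow> real" where
  "list_epsilon_flexibility G t =
     (if list_chromatic_number G \<le> t
      then GREATEST \<epsilon>. \<epsilon> \<in> {0..1} \<and> flexible G t \<epsilon>
      else undefined)"

end

theory Submission
  imports Defs
begin

text \<open>
  Let \<open>U\<close> be the part of size 3. A coloring of \<open>U\<close> extends to the other part \<open>V\<close> iff its palette is
  not a list of \<open>V\<close>, and then every request on \<open>V\<close> for a color outside the palette can be met. So
  \<open>k\<close> such colorings which together meet every request on \<open>U\<close> and have no common color give
  \<open>1/k\<close>-flexibility. For lists of size at least 4 take the request itself and a coloring that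
  avoids its colors. For lists of size 3, if the lists of \<open>U\<close> are disjoint then their 27 choices
  split into 9 lines in direction \<open>(1, 1, 1)\<close> of the cube \<open>(\<int>/3)\<^sup>3\<close>; with \<open>n \<le> 8\<close> one of the lines
  meets no list of \<open>V\<close>, and its three points are the required colorings. Likewise, for \<open>n = 3\<close> one
  of the 4 antipodal pairs of a subcube \<open>(\<int>/2)\<^sup>3\<close> is free. Overlapping lists admit colorings that
  repeat a color, which no list of \<open>V\<close> blocks.

  The upper bounds block every choice extending the request: one requested color on \<open>U\<close>
  lies in 9 choices, and 7 choices contain at least two of three requested colors.
\<close>

subsection \<open>Colorings of the small part\<close>

lemma card3_E:
  assumes "card A = 3" "x \<in> A"
  obtains p q where "A = {x, p, q}" "p \<noteq> x" "q \<noteq> x" "p \<noteq> q"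
proof -
  have "card (A - {x}) = 2"
    using assms by (simp add: card_Diff_singleton_if)
  then obtain p q where "A - {x} = {p, q}" "p \<noteq> q"
    by (meson card_2_iff)
  with assms(2) have "A = {x, p, q}" "p \<noteq> x" "q \<noteq> x"
    by (blast, blast, blast)
  with \<open>p \<noteq> q\<close> that show thesis by blast
qed

text \<open>
  \<open>A\<close>, \<open>B\<close>, \<open>C\<close> are the lists of the three vertices of the small part, \<open>x\<close>, \<open>y\<close>, \<open>z\<close> their
  requests, and \<open>F\<close> is the set of lists of the other part.
\<close>

definition covered ::
    "'c set set \<Rightarrow> 'c set \<Rightarrow> 'c set \<Rightarrow> 'c set \<Rightarrow> 'c \<Rightarrow> 'c \<Rightarrow> 'c \<Rightarrow> nat \<Rightarrow> bool" where
  "covered F A B C x y z k \<longleftrightarrow> (\<exists>fs. length fs = k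
     \<and> (\<forall>(a, b, c) \<in> set fs. a \<in> A \<and> b \<in> B \<and> c \<in> C \<and> {a, b, c} \<notin> F)
     \<and> (\<exists>(a, b, c) \<in> set fs. a = x) \<and> (\<exists>(a, b, c) \<in> set fs. b = y) \<and> (\<exists>(a, b, c) \<in> set fs. c = z)
     \<and> (\<forall>p \<in> \<Union>F. \<exists>(a, b, c) \<in> set fs. p \<notin> {a, b, c}))"

text \<open>Together with \<open>covered_swap23\<close> this generates all permutations of the three
  vertices, so later lemmas may fix the order in which the lists play their roles.\<close>

lemma covered_swap12:
  assumes "covered F B A C y x z k"
  shows "covered F A B C x y z k"
proof -
  from assms obtain fs where fs: "length fs = k"
     "\<forall>(a, b, c) \<in> set fs. a \<in> B \<and> b \<in> A \<and> c \<in> C \<and> {a, b, c} \<notin> F"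
     "\<exists>(a, b, c) \<in> set fs. a = y" "\<exists>(a, b, c) \<in> set fs. b = x" "\<exists>(a, b, c) \<in> set fs. c = z"
     "\<forall>p \<in> \<Union>F. \<exists>(a, b, c) \<in> set fs. p \<notin> {a, b, c}"
    unfolding covered_def by auto
  show ?thesis
    unfolding covered_def
    using fs by (intro exI[of _ "map (\<lambda>(a, b, c). (b, a, c)) fs"])
      (simp add: case_prod_unfold insert_commute conj_ac)
qed

lemma covered_swap23:
  assumes "covered F A C B x z y k"
  shows "covered F A B C x y z k"
proof -
  from assms obtain fs where fs: "length fs = k"
     "\<forall>(a, b, c) \<in> set fs. a \<in> A \<and> b \<in> C \<and> c \<in> B \<and> {a, b, c} \<notin> F"
     "\<exists>(a, b, c) \<in> set fs. a = x" "\<exists>(a, b, c) \<in> set fs. b = z" "\<exists>(a, b, c) \<in> set fs. c = y"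
     "\<forall>p \<in> \<Union>F. \<exists>(a, b, c) \<in> set fs. p \<notin> {a, b, c}"
    unfolding covered_def by auto
  show ?thesis
    unfolding covered_def
    using fs by (intro exI[of _ "map (\<lambda>(a, b, c). (a, c, b)) fs"])
      (simp add: case_prod_unfold insert_commute conj_ac)
qed

lemma covered2I:
  assumes "a \<in> A" "b \<in> B" "c \<in> C" "{a, b, c} \<notin> F"
    and "a' \<in> A" "b' \<in> B" "c' \<in> C" "{a', b', c'} \<notin> F"
    and "x \<in> {a, a'}" "y \<in> {b, b'}" "z \<in> {c, c'}"
    and "{a, b, c} \<inter> {a', b', c'} = {}"
  shows "covered F A B C x y z 2"
  unfolding covered_def
  using assms by (intro exI[of _ "[(a, b, c), (a', b', c')]"]) auto

lemma covered3I:
  assumes "a \<in> A" "b \<in> B" "c \<in> C" "{a, b, c} \<notin> F"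
    and "a' \<in> A" "b' \<in> B" "c' \<in> C" "{a', b', c'} \<notin> F"
    and "a'' \<in> A" "b'' \<in> B" "c'' \<in> C" "{a'', b'', c''} \<notin> F"
    and "x \<in> {a, a', a''}" "y \<in> {b, b', b''}" "z \<in> {c, c', c''}"
    and "{a, b, c} \<inter> {a', b', c'} \<inter> {a'', b'', c''} \<inter> \<Union>F = {}"
  shows "covered F A B C x y z 3"
  unfolding covered_def
proof (intro exI conjI)
  let ?fs = "[(a, b, c), (a', b', c'), (a'', b'', c'')]"
  show "length ?fs = 3" by simp
  show "\<forall>p \<in> \<Union>F. \<exists>(a, b, c) \<in> set ?fs. p \<notin> {a, b, c}"
  proof
    fix p assume "p \<in> \<Union>F"
    with assms(16) have "p \<notin> {a, b, c} \<or> p \<notin> {a', b', c'} \<or> p \<notin> {a'', b'', c''}"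
      by blast
    then show "\<exists>(a, b, c) \<in> set ?fs. p \<notin> {a, b, c}" by auto
  qed
qed (use assms(1-15) in auto)

text \<open>A palette with a repetition has fewer than three colors, so no list of size 3 equals it.
  The forms \<open>{a, b}\<close> and \<open>{a}\<close> are what simplification makes of such a
  palette.\<close>

lemma repeated_notin:
  assumes "\<forall>S \<in> F. card S = 3"
  shows "a = b \<or> a = c \<or> b = c \<Longrightarrow> {a, b, c} \<notin> F"
    and "{a, b} \<notin> F" and "{a} \<notin> F"
proof -
  have two: "{p, q} \<notin> F" for p q
  proof
    assume "{p, q} \<in> F"
    with assms have "card {p, q} = 3" by blast
    then show False by (simp add: card_insert_if split: if_splits)
  qed
  then show "{a, b} \<notin> F" .
  show "{a} \<notin> F" using two[of a a] by simp
  show "{a, b, c} \<notin> F" if "a = b \<or> a = c \<or> b = c"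
    using that two[of a b] two[of a c] by (auto simp: insert_commute)
qed

text \<open>Colors of \<open>B\<close> and \<open>C\<close> cannot trade places, these lists being
  disjoint. Trading a color of \<open>A\<close> with one of \<open>B\<close> or \<open>C\<close>
  would put two distinct colors into an intersection that has at most one. One shared color is
  allowed for the sake of \<open>covered3_sparse\<close>.\<close>

lemma palette_unique:
  assumes "a \<in> A" "b \<in> B" "c \<in> C" "a' \<in> A" "b' \<in> B" "c' \<in> C"
    and "{a, b, c} = {a', b', c'}" "a \<noteq> b" "a \<noteq> c" "b \<noteq> c"
    and AB: "\<And>p q. p \<in> A \<inter> B \<Longrightarrow> q \<in> A \<inter> B \<Longrightarrow> p = q"
    and AC: "\<And>p q. p \<in> A \<inter> C \<Longrightarrow> q \<in> A \<inter> C \<Longrightarrow> p = q"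
    and BC: "B \<inter> C = {}"
  shows "a = a' \<and> b = b' \<and> c = c'"
proof -
  from assms(7) have in1: "a \<in> {a', b', c'}" "b \<in> {a', b', c'}" "c \<in> {a', b', c'}" 
    by blast+
  have bc: "b \<noteq> c'" "c \<noteq> b'"
    using assms(2,3,5,6) BC by auto
  have "a = a'"
  proof (rule ccontr)
    assume ne: "a \<noteq> a'"
    with in1(1) consider "a = b'" | "a = c'" by blast
    then show False
    proof cases
      case 1
      with in1(2) assms(8) bc have "b = a'" by auto
      with 1 show False using AB[of a b] assms(1,2,4,5) ne by auto
    next
      case 2
      with in1(3) assms(9) bc have "c = a'" by auto
      with 2 show False using AC[of a c] assms(1,3,4,6) ne by auto
    qed
  qed
  with in1 bc assms(8,9) show ?thesis by auto
qed

lemma inj_on_palette: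
  assumes "A \<inter> B = {}" "A \<inter> C = {}" "B \<inter> C = {}"
  shows "inj_on (\<lambda>(a, b, c). {a, b, c}) (A \<times> B \<times> C)"
proof (rule inj_onI)
  let ?p = "\<lambda>(a, b, c). {a, b, c}"
  fix s t assume st: "s \<in> A \<times> B \<times> C" "t \<in> A \<times> B \<times> C" "?p s = ?p t"
  obtain a b c a' b' c' where "s = (a, b, c)" "t = (a', b', c')"
    by (metis prod.exhaust)
  with st show "s = t"
    using palette_unique[of a A b B c C a' b' c'] assms by auto
qed

text \<open>If every choice were blocked, no choice would repeat a color. The lists would then be
  pairwise disjoint, all palettes distinct, and \<open>F\<close> too small to hold them.\<close>

lemma exists_unblocked:
  assumes "finite F" "\<forall>S \<in> F. card S = 3" "card F < card A * card B * card C"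
  shows "\<exists>a \<in> A. \<exists>b \<in> B. \<exists>c \<in> C. {a, b, c} \<notin> F"
proof (rule ccontr)
  assume "\<not> ?thesis"
  then have blocked: "{a, b, c} \<in> F" if "a \<in> A" "b \<in> B" "c \<in> C" for a b c
    using that by blast
  have ne: "a \<noteq> b \<and> a \<noteq> c \<and> b \<noteq> c" if "a \<in> A" "b \<in> B" "c \<in> C" for a b c
    using blocked[OF that] repeated_notin[OF assms(2)] by blast
  have "A \<noteq> {}" "B \<noteq> {}" "C \<noteq> {}"
    using assms(3) by auto
  then have disj: "A \<inter> B = {}" "A \<inter> C = {}" "B \<inter> C = {}"
    using ne by blast+
  let ?p = "\<lambda>(a, b, c). {a, b, c}"
  have "inj_on ?p (A \<times> B \<times> C)"
    by (rule inj_on_palette) (fact disj)+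
  moreover have "?p ` (A \<times> B \<times> C) \<subseteq> F"
    using blocked by auto
  ultimately have "card (A \<times> B \<times> C) \<le> card F"
    using assms(1) by (metis card_image card_mono)
  with assms(3) show False by (simp add: card_cartesian_product)
qed

subsection \<open>Two colorings\<close>

text \<open>Coloring the first two vertices with \<open>x\<close> is never blocked. It remains to
  meet \<open>y\<close>, and if necessary \<open>z\<close>, by a second coloring disjoint from the
  first.\<close>

lemma covered2_foreign:
  assumes F: "finite F" "\<forall>S \<in> F. card S = 3" "card F \<le> 3"
    and cards: "card A = 3" "card B = 3" "card C = 3"
    and mem: "x \<in> A" "y \<in> B" "z \<in> C"
    and ne: "x \<noteq> y" "x \<noteq> z" "y \<noteq> z" and "x \<in> B"
  shows "covered F A B C x y z 2"
proof -
  note good = repeated_notin[OF F(2)]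
  obtain a1 a2 where A: "A = {x, a1, a2}" "a1 \<noteq> x" "a2 \<noteq> x" "a1 \<noteq> a2"
    using card3_E[OF cards(1) mem(1)] .
  obtain c1 c2 where C: "C = {z, c1, c2}" "c1 \<noteq> z" "c2 \<noteq> z" "c1 \<noteq> c2"
    using card3_E[OF cards(3) mem(3)] .
  show ?thesis
  proof (cases "y \<in> A \<or> z \<in> A")
    case True
    then obtain a where a: "a \<in> A" "a = y \<or> a = z" by blast
    obtain c where c: "c \<in> C" "c \<noteq> y" "c \<noteq> z" using C by blast
    show ?thesis
      by (rule covered2I[of x A x B c C F a y z]) (use a c mem ne \<open>x \<in> B\<close> good in auto)
  next
    case out: False
    show ?thesis
    proof (cases "\<exists>a \<in> {a1, a2, y}. a \<in> C")
      case True
      then obtain a where a: "a \<in> {a1, a2, y}" "a \<in> C" by blast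
      \<comment> \<open>Either way the second coloring \<open>(a', y, a)\<close> repeats a color:
        \<open>a\<close> itself, or \<open>y\<close> if \<open>a = y\<close>.\<close>
      define a' where "a' = (if a = y then a1 else a)"
      show ?thesis
        by (rule covered2I[of x A x B z C F a' y a])
          (use a A mem ne \<open>x \<in> B\<close> good out in \<open>auto simp: a'_def\<close>)
    next
      case False
      obtain c where c: "c \<in> C" "c \<noteq> x" "c \<noteq> z"
        using C by (cases "c1 = x"; blast)
      \<comment> \<open>Four choices against at most three lists.\<close>
      have "card F < card {a1, a2} * card {y} * card {z, c}"
        using F(3) A(4) c(3) by simp
      then obtain a c' where ac: "a \<in> {a1, a2}" "c' \<in> {z, c}" "{a, y, c'} \<notin> F"
        using exists_unblocked[OF F(1,2)] by blast
      then have a: "a \<in> A" "a \<noteq> x" "a \<noteq> y" "a \<noteq> z" "a \<notin> C"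
        using A out False by auto
      have c': "c' \<in> C" "c' \<noteq> x"
        using ac(2) c C(1) ne by auto
      \<comment> \<open>If the second coloring misses \<open>z\<close>, then the first one takes it;
        otherwise the first one takes \<open>c\<close>.\<close>
      obtain c'' where c'': "c'' \<in> C" "z \<in> {c'', c'}" "c'' \<noteq> c'"
        using ac(2) c C(1) by blast
      have "y \<notin> C" using False by blast
      with a c' c'' have "{x, x, c''} \<inter> {a, y, c'} = {}" using ne by auto
      moreover have "{x, x, c''} \<notin> F" using good(1) by blast
      ultimately show ?thesis
        by (intro covered2I[OF mem(1) \<open>x \<in> B\<close> c''(1) _ a(1) mem(2) c'(1) ac(3)])
          (use c''(2) in simp_all)
    qed
  qed
qed

text \<open>Pigeonhole: each list blocks at most one line. Disjointness is asked only inside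
  \<open>F\<close>, since palettes with repetitions may lie on several lines.\<close>

lemma exists_unblocked_line:
  assumes "finite F" "card F < card I"
    and disj: "\<And>i j. i \<in> I \<Longrightarrow> j \<in> I \<Longrightarrow> i \<noteq> j \<Longrightarrow> P i \<inter> P j \<inter> F = {}"
  shows "\<exists>i \<in> I. P i \<inter> F = {}"
proof (rule ccontr)
  assume "\<not> ?thesis"
  then have "\<forall>i \<in> I. \<exists>S. S \<in> P i \<inter> F" by blast
  then obtain f where f: "\<And>i. i \<in> I \<Longrightarrow> f i \<in> P i \<inter> F" by metis
  have "inj_on f I"
    using f disj by (intro inj_onI) (metis IntI empty_iff IntE)
  moreover have "f ` I \<subseteq> F" using f by blast
  ultimately have "card I \<le> card F"
    using assms(1) card_inj_on_le by blast
  with assms(2) show False by simp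
qed

text \<open>The constant coloring \<open>x\<close> is free, and of the eight choices avoiding
  \<open>x\<close> at most three are blocked.\<close>

lemma covered2_equal3:
  assumes F: "finite F" "\<forall>S \<in> F. card S = 3" "card F \<le> 3"
    and cards: "card A = 3" "card B = 3" "card C = 3"
    and mem: "x \<in> A" "x \<in> B" "x \<in> C"
  shows "covered F A B C x x x 2"
proof -
  have "card F < card (A - {x}) * card (B - {x}) * card (C - {x})"
    using cards mem F(3) by (simp add: card_Diff_singleton_if)
  then obtain a b c where abc: "a \<in> A - {x}" "b \<in> B - {x}" "c \<in> C - {x}" "{a, b, c} \<notin> F"
    using exists_unblocked[OF F(1,2)] by blast
  show ?thesis
    by (rule covered2I[of x A x B x C F a b c]) (use abc mem repeated_notin[OF F(2)] in auto)
qed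

text \<open>If \<open>z\<close> lies in \<open>A\<close> or \<open>B\<close>, two colorings with
  repetitions suffice. Otherwise one of the four choices that avoid \<open>x\<close> on the first
  two vertices and end in \<open>z\<close> is free, say \<open>(a, b, z)\<close>. It goes with
  \<open>(x, x, c)\<close> for a \<open>c\<close> outside \<open>{a, b, z}\<close>; if
  \<open>a\<close> lies in \<open>C\<close>, where such a \<open>c\<close> may be missing,
  \<open>(x, x, z)\<close> and \<open>(a, b, a)\<close> serve instead.\<close>

lemma covered2_equal2:
  assumes F: "finite F" "\<forall>S \<in> F. card S = 3" "card F \<le> 3"
    and cards: "card A = 3" "card B = 3" "card C = 3"
    and mem: "x \<in> A" "x \<in> B" "z \<in> C" and "x \<noteq> z"
  shows "covered F A B C x x z 2"
proof -
  note good = repeated_notin[OF F(2)]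
  obtain a1 a2 where A: "A = {x, a1, a2}" "a1 \<noteq> x"
    using card3_E[OF cards(1) mem(1)] .
  obtain b1 b2 where B: "B = {x, b1, b2}" "b1 \<noteq> x"
    using card3_E[OF cards(2) mem(2)] .
  have third: "\<exists>c \<in> C. c \<noteq> z \<and> c \<noteq> p" for p
  proof -
    obtain c1 c2 where "C = {z, c1, c2}" "c1 \<noteq> z" "c2 \<noteq> z" "c1 \<noteq> c2"
      using card3_E[OF cards(3) mem(3)] .
    then show ?thesis by (cases "c1 = p") auto
  qed
  consider "z \<in> A" | "z \<in> B" | "z \<notin> A" "z \<notin> B" by blast
  then show ?thesis
  proof cases
    case 1
    obtain c where "c \<in> C" "c \<noteq> z" "c \<noteq> b1" using third by blast
    with 1 show ?thesis
      by (intro covered2I[of x A x B c C F z b1 z]) (use B mem \<open>x \<noteq> z\<close> good in auto)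
  next
    case 2
    obtain c where "c \<in> C" "c \<noteq> z" "c \<noteq> a1" using third by blast
    with 2 show ?thesis
      by (intro covered2I[of x A x B c C F a1 z z]) (use A mem \<open>x \<noteq> z\<close> good in auto)
  next
    case 3
    have "card F < card (A - {x}) * card (B - {x}) * card {z}"
      using cards mem F(3) by (simp add: card_Diff_singleton_if)
    then obtain a b where ab: "a \<in> A - {x}" "b \<in> B - {x}" "{a, b, z} \<notin> F"
      using exists_unblocked[OF F(1,2)] by blast
    show ?thesis
    proof (cases "a \<in> C")
      case True
      show ?thesis
        by (rule covered2I[of x A x B z C F a b a]) (use True 3 ab mem \<open>x \<noteq> z\<close> good in auto)
    next
      case False
      obtain c where "c \<in> C" "c \<noteq> z" "c \<noteq> b" using third by blast
      then show ?thesis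
        by (intro covered2I[of x A x B c C F a b z])
          (use False ab mem \<open>x \<noteq> z\<close> good in auto)
    qed
  qed
qed

text \<open>Hall's condition for three pairs fails only when all three pairs coincide.\<close>

lemma distinct_representatives:
  assumes "card A = 2" "card B = 2" "card C = 2" "\<not> (A = B \<and> B = C)"
  obtains a b c where "a \<in> A" "b \<in> B" "c \<in> C" "a \<noteq> b" "a \<noteq> c" "b \<noteq> c"
proof -
  obtain a a' b b' c c' where e: "A = {a, a'}" "B = {b, b'}" "C = {c, c'}"
    and ne: "a \<noteq> a'" "b \<noteq> b'" "c \<noteq> c'"
    using assms(1-3) by (auto simp: card_2_iff)
  have "\<exists>p \<in> A. \<exists>q \<in> B. \<exists>r \<in> C. p \<noteq> q \<and> p \<noteq> r \<and> q \<noteq> r"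
    using assms(4) ne unfolding e by (simp add: doubleton_eq_iff) metis
  with that show thesis by blast
qed

text \<open>With distinct representatives of the unrequested colors, the antipodal pairs of a
  subcube can be used. Representatives fail to exist only if the three lists share both unrequested
  colors, and then colorings that repeat a shared color help.\<close>

lemma covered2_separate:
  assumes F: "finite F" "\<forall>S \<in> F. card S = 3" "card F \<le> 3"
    and cards: "card A = 3" "card B = 3" "card C = 3"
    and mem: "x \<in> A" "y \<in> B" "z \<in> C"
    and out: "x \<notin> B" "x \<notin> C" "y \<notin> A" "y \<notin> C" "z \<notin> A" "z \<notin> B"
  shows "covered F A B C x y z 2"
proof (cases "A - {x} = B - {y} \<and> B - {y} = C - {z}")
  case True
  note good = repeated_notin[OF F(2)]
  obtain u v where A: "A = {x, u, v}" "u \<noteq> x" "v \<noteq> x" "u \<noteq> v"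
    using card3_E[OF cards(1) mem(1)] .
  then have uv: "u \<in> B" "u \<in> C" "v \<in> B" "v \<in> C" "u \<noteq> y" "u \<noteq> z" "v \<noteq> y" "v \<noteq> z"
    using True by blast+
  have xyz: "x \<noteq> y" "x \<noteq> z" "y \<noteq> z" using mem out by auto
  \<comment> \<open>Four distinct palettes, so one is free. Each is complemented below by a disjoint
    coloring that repeats \<open>u\<close> or \<open>v\<close> and takes the requests it
    misses.\<close>
  have "\<not> {{x, y, z}, {v, y, z}, {u, y, z}, {x, v, z}} \<subseteq> F"
  proof
    assume sub: "{{x, y, z}, {v, y, z}, {u, y, z}, {x, v, z}} \<subseteq> F"
    have "{x, y, z} \<noteq> {v, y, z}" "{x, y, z} \<noteq> {u, y, z}" "{x, y, z} \<noteq> {x, v, z}"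
      "{v, y, z} \<noteq> {u, y, z}" "{v, y, z} \<noteq> {x, v, z}" "{u, y, z} \<noteq> {x, v, z}"
      using A(2-4) uv xyz by (metis insert_iff singletonD)+
    then have "card {{x, y, z}, {v, y, z}, {u, y, z}, {x, v, z}} = 4" by simp
    with card_mono[OF F(1) sub] F(3) show False by simp
  qed
  then consider "{x, y, z} \<notin> F" | "{v, y, z} \<notin> F" | "{u, y, z} \<notin> F" | "{x, v, z} \<notin> F"
    by blast
  then show ?thesis
  proof cases
    case 1
    then show ?thesis
      by (intro covered2I[of x A y B z C F u u u]) (use mem A(1-3) uv good in auto)
  next
    case 2
    then show ?thesis
      by (intro covered2I[of v A y B z C F x u u]) (use mem A uv xyz good in auto)
  next
    case 3
    then show ?thesis
      by (intro covered2I[of u A y B z C F x v v]) (use mem A uv xyz good in auto)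
  next
    case 4
    then show ?thesis
      by (intro covered2I[of x A v B z C F u y u]) (use mem A uv xyz good in auto)
  qed
next
  case False
  have "card (A - {x}) = 2" "card (B - {y}) = 2" "card (C - {z}) = 2"
    using cards mem by (simp_all add: card_Diff_singleton_if)
  then obtain a b c where abc: "a \<in> A - {x}" "b \<in> B - {y}" "c \<in> C - {z}" "a \<noteq> b" "a \<noteq> c" "b \<noteq> c"
    using distinct_representatives[OF _ _ _ False] by metis
  then have abc': "a \<notin> {x, y, z}" "b \<notin> {x, y, z}" "c \<notin> {x, y, z}"
    using out by auto
  have xyz: "x \<noteq> y" "x \<noteq> z" "y \<noteq> z" using mem out by auto
  \<comment> \<open>The truth value \<open>True\<close> selects the requested color. The first
    vertex has \<open>x\<close> in the first member of each pair, so \<open>(j, k)\<close> indexes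
    the four antipodal pairs once each.\<close>
  define \<beta> \<gamma> where "\<beta> j = (if j then y else b)" and "\<gamma> k = (if k then z else c)" for j k
  define P where "P = (\<lambda>(j, k). {{x, \<beta> j, \<gamma> k}, {a, \<beta> (\<not> j), \<gamma> (\<not> k)}})"
  have "\<exists>i \<in> UNIV. P i \<inter> F = {}"
  proof (rule exists_unblocked_line)
    show "card F < card (UNIV :: (bool \<times> bool) set)"
      using F(3) by (simp add: card_cartesian_product flip: UNIV_Times_UNIV)
    have inj: "inj_on (\<lambda>(a, b, c). {a, b, c}) ({x, a} \<times> range \<beta> \<times> range \<gamma>)"
      by (rule inj_on_palette) (use abc abc' xyz in \<open>auto simp: \<beta>_def \<gamma>_def\<close>)
    have uniq: "p = p' \<and> \<beta> j = \<beta> j' \<and> \<gamma> k = \<gamma> k'"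
      if "{p, \<beta> j, \<gamma> k} = {p', \<beta> j', \<gamma> k'}" "p \<in> {x, a}" "p' \<in> {x, a}" for p p' j j' k k'
      using inj_onD[OF inj, of "(p, \<beta> j, \<gamma> k)" "(p', \<beta> j', \<gamma> k')"] that by auto
    have \<beta>\<gamma>: "\<beta> j = \<beta> j' \<longleftrightarrow> j = j'" "\<gamma> k = \<gamma> k' \<longleftrightarrow> k = k'" for j j' k k'
      using abc by (auto simp: \<beta>_def \<gamma>_def)
    show "P i \<inter> P j \<inter> F = {}" if "i \<noteq> j" for i j
    proof (rule equals0I)
      fix S assume S: "S \<in> P i \<inter> P j \<inter> F"
      obtain p q p' q' where ij: "i = (p, q)" "j = (p', q')" by (metis prod.exhaust)
      have "x \<noteq> a" using abc by blast
      from S ij have "S = {x, \<beta> p, \<gamma> q} \<or> S = {a, \<beta> (\<not> p), \<gamma> (\<not> q)}"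
        "S = {x, \<beta> p', \<gamma> q'} \<or> S = {a, \<beta> (\<not> p'), \<gamma> (\<not> q')}"
        by (auto simp: P_def)
      then have "p = p' \<and> q = q'"
        using \<open>x \<noteq> a\<close> uniq[of x p q x p' q', unfolded \<beta>\<gamma>] uniq[of x p q a "\<not> p'" "\<not> q'", unfolded \<beta>\<gamma>]
          uniq[of a "\<not> p" "\<not> q" x p' q', unfolded \<beta>\<gamma>]
          uniq[of a "\<not> p" "\<not> q" a "\<not> p'" "\<not> q'", unfolded \<beta>\<gamma>]
        by blast
      with ij that show False by simp
    qed
  qed (fact F(1))
  then obtain j k where "P (j, k) \<inter> F = {}" by auto
  then have "{x, \<beta> j, \<gamma> k} \<notin> F" "{a, \<beta> (\<not> j), \<gamma> (\<not> k)} \<notin> F" by (auto simp: P_def)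
  then show ?thesis
    by (intro covered2I[of x A "\<beta> j" B "\<gamma> k" C F a "\<beta> (\<not> j)" "\<gamma> (\<not> k)"])
      (use abc abc' xyz mem in \<open>auto simp: \<beta>_def \<gamma>_def split: if_splits\<close>)
qed

text \<open>The cases are which requests coincide and, if none do, whether some request also lies in
  the list of another vertex; permuting the vertices reduces them to the lemmas above.\<close>

lemma covered2:
  assumes F: "finite F" "\<forall>S \<in> F. card S = 3" "card F \<le> 3"
    and cards: "card A = 3" "card B = 3" "card C = 3"
    and mem: "x \<in> A" "y \<in> B" "z \<in> C"
  shows "covered F A B C x y z 2"
proof -
  note swaps = covered_swap12 covered_swap23
  consider "x = y" "y = z" | "x = y" "y \<noteq> z" | "x = z" "y \<noteq> z" | "y = z" "x \<noteq> z"
    | "x \<noteq> y" "x \<noteq> z" "y \<noteq> z" by blast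
  then show ?thesis
  proof cases
    case 1
    with mem show ?thesis using covered2_equal3[OF F cards] by simp
  next
    case 2
    with mem show ?thesis using covered2_equal2[OF F cards] by simp
  next
    case 3
    then have "covered F A C B x x y 2"
      using covered2_equal2[OF F cards(1,3,2)] mem by blast
    with 3 show ?thesis by (simp add: covered_swap23)
  next
    case 4
    then have "covered F B C A y y x 2"
      using covered2_equal2[OF F cards(2,3,1)] mem by blast
    with 4 show ?thesis using swaps by metis
  next
    case 5
    note f = covered2_foreign[OF F]
    consider "x \<in> B" | "x \<in> C" | "y \<in> A" | "y \<in> C" | "z \<in> A" | "z \<in> B"
      | "x \<notin> B" "x \<notin> C" "y \<notin> A" "y \<notin> C" "z \<notin> A" "z \<notin> B" by blast
    then show ?thesis
    proof cases
      case 1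
      show ?thesis by (rule f) (use cards mem 5 1 in auto)
    next
      case 2
      show ?thesis by (rule covered_swap23, rule f) (use cards mem 5 2 in auto)
    next
      case 3
      show ?thesis by (rule covered_swap12, rule f) (use cards mem 5 3 in auto)
    next
      case 4
      show ?thesis by (rule covered_swap12, rule covered_swap23, rule f) (use cards mem 5 4 in auto)
    next
      case 5
      show ?thesis by (rule covered_swap23, rule covered_swap12, rule f)
          (use cards mem \<open>x \<noteq> y\<close> \<open>x \<noteq> z\<close> \<open>y \<noteq> z\<close> 5 in auto)
    next
      case 6
      show ?thesis by (rule covered_swap23, rule covered_swap12, rule covered_swap23, rule f)
          (use cards mem \<open>x \<noteq> y\<close> \<open>x \<noteq> z\<close> \<open>y \<noteq> z\<close> 6 in auto)
    next
      case 7
      with F cards mem show ?thesis by (intro covered2_separate)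
    qed
  qed
qed

subsection \<open>Three colorings\<close>

text \<open>The three colorings use every color of each list exactly once at its vertex, so every
  request is met. A color missing from one of the lists occurs at most twice in all, hence not in
  all three palettes.\<close>

lemma covered3_latin:
  assumes A: "A = {a, a', a''}" "card A = 3" and B: "B = {b, b', b''}" "card B = 3"
    and C: "C = {c, c', c''}" "card C = 3" and "A \<inter> B \<inter> C = {}"
    and mem: "x \<in> A" "y \<in> B" "z \<in> C"
    and good: "{a, b, c} \<notin> F" "{a', b', c'} \<notin> F" "{a'', b'', c''} \<notin> F"
  shows "covered F A B C x y z 3"
proof -
  have dist: "distinct [a, a', a'']" "distinct [b, b', b'']" "distinct [c, c', c'']"
    using A B C by (auto simp: card_insert_if split: if_splits)
  have "p \<notin> {a, b, c} \<inter> {a', b', c'} \<inter> {a'', b'', c''}" for p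
  proof -
    have "p \<notin> A \<or> p \<notin> B \<or> p \<notin> C" using assms(7) by blast
    with A B C dist show ?thesis by auto
  qed
  then have "{a, b, c} \<inter> {a', b', c'} \<inter> {a'', b'', c''} \<inter> \<Union>F = {}" by blast
  then show ?thesis
    using good mem A(1) B(1) C(1)
    by (intro covered3I[of a A b B c C F a' b' c' a'' b'' c'']) auto
qed

text \<open>With \<open>p\<close>, \<open>q\<close>, \<open>r\<close> in the three pairwise
  intersections, the colorings \<open>(p, p, c)\<close>, \<open>(q, b, q)\<close>,
  \<open>(a, r, r)\<close> exhaust the lists, and each repeats a color.\<close>

lemma covered3_triangle:
  fixes A B C :: "'c set"
  assumes "\<forall>S \<in> F. card S = 3"
    and cards: "card A = 3" "card B = 3" "card C = 3"
    and mem: "x \<in> A" "y \<in> B" "z \<in> C"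
    and ABC: "A \<inter> B \<inter> C = {}" and "A \<inter> B \<noteq> {}" "A \<inter> C \<noteq> {}" "B \<inter> C \<noteq> {}"
  shows "covered F A B C x y z 3"
proof -
  obtain p q r where pqr: "p \<in> A" "p \<in> B" "q \<in> A" "q \<in> C" "r \<in> B" "r \<in> C"
    using assms(9-11) by blast
  then have ne: "p \<noteq> q" "p \<noteq> r" "q \<noteq> r" using ABC by blast+
  have third: "\<exists>s. X = {u, v, s}" if h: "card X = 3" "u \<in> X" "v \<in> X" "u \<noteq> v" for X :: "'c set" and u v
  proof -
    obtain s t where "X = {u, s, t}" using card3_E[OF h(1,2)] .
    with h(3,4) show ?thesis by blast
  qed
  obtain a b c where "A = {p, q, a}" "B = {p, r, b}" "C = {q, r, c}"
    using third[of A p q] third[of B p r] third[of C q r] cards pqr ne by blast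
  then have "A = {p, q, a}" "B = {p, b, r}" "C = {c, q, r}" by auto
  then show ?thesis
    by (rule covered3_latin[OF _ cards(1) _ cards(2) _ cards(3) ABC mem])
      (use repeated_notin[OF assms(1)] in auto)
qed

text \<open>Putting \<open>p\<close> or \<open>q\<close> on both of the first two vertices gives
  colorings that are free of charge. What remains to be avoided is spread over nine disjoint sets of
  palettes, one more than the number of lists.\<close>

lemma covered3_double:
  assumes F: "finite F" "\<forall>S \<in> F. card S = 3" "card F \<le> 8"
    and cards: "card A = 3" "card B = 3" "card C = 3"
    and mem: "x \<in> A" "y \<in> B" "z \<in> C"
    and BC: "B \<inter> C = {}" and pq: "p \<in> A \<inter> B" "q \<in> A \<inter> B" "p \<noteq> q"
  shows "covered F A B C x y z 3"
proof -
  note good = repeated_notin[OF F(2)]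
  have ABC: "A \<inter> B \<inter> C = {}" using BC by blast
  have third: "\<exists>s. X = {p, q, s} \<and> s \<noteq> p \<and> s \<noteq> q" if h: "card X = 3" "p \<in> X" "q \<in> X" for X
  proof -
    obtain s t where "X = {p, s, t}" "s \<noteq> p" "t \<noteq> p" "s \<noteq> t" using card3_E[OF h(1,2)] .
    with h(3) pq(3) show ?thesis by (cases "q = s") auto
  qed
  obtain a b where A: "A = {p, q, a}" "a \<noteq> p" "a \<noteq> q" and B: "B = {p, q, b}" "b \<noteq> p" "b \<noteq> q"
    using third[OF cards(1)] third[OF cards(2)] pq by blast
  note latin = covered3_latin[OF _ cards(1) _ cards(2) _ cards(3) ABC mem]
  consider "a \<in> C" | "a = b" | "a \<notin> C" "a \<noteq> b" by blast
  then show ?thesis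
  proof cases
    case 1
    then obtain s t where "C = {a, s, t}" using card3_E[OF cards(3)] by blast
    with A B good show ?thesis
      by (intro latin[of p q a p q b s t a]) auto
  next
    case 2
    obtain s t where "C = {z, s, t}" using card3_E[OF cards(3) mem(3)] .
    with A B good 2 show ?thesis
      by (intro latin[of p q a p q b z s t]) auto
  next
    case 3
    obtain c0 c1 c2 where C: "C = {c0, c1, c2}" "c1 \<noteq> c0" "c2 \<noteq> c0" "c1 \<noteq> c2"
      using card3_E[OF cards(3) mem(3)] .
    have out: "p \<notin> C" "q \<notin> C" "a \<notin> C" "b \<notin> C"
      using BC pq 3 B by blast+
    \<comment> \<open>The pairs on the first two vertices that occur in colorings without
      repetition. As their colors lie outside \<open>C\<close>, a palette splits into its color in
      \<open>C\<close> and the rest, which determines the pair.\<close>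
    define Z where "Z = {(a, b), (q, b), (a, q), (p, b), (a, p)}"
    have Zinj: "s = s' \<and> c = c'"
      if "s \<in> Z" "s' \<in> Z" "c \<in> C" "c' \<in> C" "{fst s, snd s, c} = {fst s', snd s', c'}"
      for s s' c c'
    proof -
      have sub: "fst s \<notin> C" "snd s \<notin> C" "fst s' \<notin> C" "snd s' \<notin> C"
        using that(1,2) out by (auto simp: Z_def)
      have "{fst s, snd s, c} \<inter> C = {c}" "{fst s', snd s', c'} \<inter> C = {c'}"
        "{fst s, snd s, c} - C = {fst s, snd s}" "{fst s', snd s', c'} - C = {fst s', snd s'}"
        using sub that(3,4) by auto
      then have "c = c'" "{fst s, snd s} = {fst s', snd s'}"
        using that(5) by (metis singleton_inject, metis)
      moreover have "s = s'" if "{fst s, snd s} = {fst s', snd s'}"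
        using that \<open>s \<in> Z\<close> \<open>s' \<in> Z\<close> A(2,3) B(2,3) 3(2) pq(3)
        by (auto simp: Z_def doubleton_eq_iff)
      ultimately show ?thesis by blast
    qed
    \<comment> \<open>Nine triples of choices; choices that repeat a color are omitted, being never blocked.\<close>
    define L where "L = [{((a, b), c0)}, {((a, b), c1)}, {((a, b), c2)},
      {((q, b), c0), ((a, q), c1)}, {((q, b), c1), ((a, q), c2)}, {((q, b), c2), ((a, q), c0)},
      {((p, b), c0), ((a, p), c1)}, {((p, b), c1), ((a, p), c2)}, {((p, b), c2), ((a, p), c0)}]"
    define P where "P i = (\<lambda>(s, c). {fst s, snd s, c}) ` (L ! i)" for i
    have L_sub: "L ! i \<subseteq> Z \<times> C" if "i < 9" for i
    proof -
      have "\<forall>T \<in> set L. T \<subseteq> Z \<times> C" by (auto simp: L_def Z_def C)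
      moreover have "length L = 9" by (simp add: L_def)
      ultimately show ?thesis using that by (metis nth_mem)
    qed
    note ne = A(2,3) B(2,3) C(2-4) 3(2) pq(3)
    have L_disj: "L ! i \<inter> L ! j = {}" if "i < j" "j < 9" for i j
    proof -
      have "sorted_wrt (\<lambda>S T. \<forall>e \<in> S. e \<notin> T) L"
        unfolding L_def using ne by simp
      moreover have "length L = 9" by (simp add: L_def)
      ultimately have "\<forall>e \<in> L ! i. e \<notin> L ! j"
        using that by (simp add: sorted_wrt_iff_nth_less)
      then show ?thesis by blast
    qed
    have "\<exists>i \<in> {..<9}. P i \<inter> F = {}"
    proof (rule exists_unblocked_line)
      show "card F < card {..<9::nat}" using F(3) by simp
      fix i j :: nat assume ij: "i \<in> {..<9}" "j \<in> {..<9}" "i \<noteq> j"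
      have inj: "inj_on (\<lambda>(s, c). {fst s, snd s, c}) (Z \<times> C)"
      proof (rule inj_onI)
        fix e e' assume "e \<in> Z \<times> C" "e' \<in> Z \<times> C"
          "(\<lambda>(s, c). {fst s, snd s, c}) e = (\<lambda>(s, c). {fst s, snd s, c}) e'"
        then show "e = e'" using Zinj[of "fst e" "fst e'" "snd e" "snd e'"]
          by (simp add: case_prod_unfold mem_Times_iff prod_eq_iff)
      qed
      have "L ! i \<inter> L ! j = {}" using L_disj[of i j] L_disj[of j i] ij by (auto simp: neq_iff)
      then have "P i \<inter> P j = {}"
        unfolding P_def using inj_on_image_Int[OF inj L_sub[of i] L_sub[of j]] ij by auto
      then show "P i \<inter> P j \<inter> F = {}" by blast
    qed (fact F(1))
    then obtain i where i: "i < 9" "P i \<inter> F = {}" by blast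
    have notin: "\<forall>e \<in> L ! i. {fst (fst e), snd (fst e), snd e} \<notin> F"
      using i(2) unfolding P_def case_prod_unfold by blast
    \<comment> \<open>The cyclic shifts of the enumeration of \<open>C\<close> turn each of the
      three patterns below into three triples.\<close>
    have C': "C = {c1, c2, c0}" "C = {c2, c0, c1}" using C by auto
    have ab: "covered F A B C x y z 3" if "{a, b, c} \<notin> F" "C = {c, d, e}" for c d e
      using that A B good by (intro latin[of a p q b p q c d e]) auto
    have q: "covered F A B C x y z 3" if "{q, b, c} \<notin> F" "{a, q, d} \<notin> F" "C = {c, d, e}" for c d e
      using that A B good by (intro latin[of q a p b q p c d e]) auto
    have p: "covered F A B C x y z 3" if "{p, b, c} \<notin> F" "{a, p, d} \<notin> F" "C = {c, d, e}" for c d e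
      using that A B good by (intro latin[of p a q b p q c d e]) auto
    have "i \<in> {0, 1, 2, 3, 4, 5, 6, 7, 8}" using i(1) by auto
    then show ?thesis
      using notin ab[OF _ C(1)] ab[OF _ C'(1)] ab[OF _ C'(2)]
        q[OF _ _ C(1)] q[OF _ _ C'(1)] q[OF _ _ C'(2)]
        p[OF _ _ C(1)] p[OF _ _ C'(1)] p[OF _ _ C'(2)]
      by (elim insertE) (simp_all add: L_def)
  qed
qed

lemma add_mod3:
  fixes i j k :: nat
  assumes "(i + j) mod 3 = (i + k) mod 3" "i < 3" "j < 3" "k < 3"
  shows "j = k"
proof -
  have "i \<in> {0, 1, 2}" "j \<in> {0, 1, 2}" "k \<in> {0, 1, 2}" using assms by auto
  with assms(1) show ?thesis by auto
qed

text \<open>The nine lines in direction \<open>(1, 1, 1)\<close> still work if \<open>A\<close>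
  shares one color with \<open>B\<close> and one with \<open>C\<close>: the lines are disjoint as
  far as palettes without repetition are concerned.\<close>

lemma covered3_sparse:
  fixes A B C :: "'c set"
  assumes F: "finite F" "\<forall>S \<in> F. card S = 3" "card F \<le> 8"
    and cards: "card A = 3" "card B = 3" "card C = 3"
    and mem: "x \<in> A" "y \<in> B" "z \<in> C"
    and AB: "\<And>p q. p \<in> A \<inter> B \<Longrightarrow> q \<in> A \<inter> B \<Longrightarrow> p = q"
    and AC: "\<And>p q. p \<in> A \<inter> C \<Longrightarrow> q \<in> A \<inter> C \<Longrightarrow> p = q"
    and BC: "B \<inter> C = {}"
  shows "covered F A B C x y z 3"
proof -
  have enum: "\<exists>f. bij_betw f {..<3::nat} X" if "card X = 3" for X :: "'c set"
    using ex_bij_betw_nat_finite[of X] that card.infinite[of X]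
    by (metis atLeast0LessThan zero_neq_numeral)
  obtain \<alpha> \<beta> \<gamma> where bij: "bij_betw \<alpha> {..<3::nat} A" "bij_betw \<beta> {..<3::nat} B" "bij_betw \<gamma> {..<3::nat} C"
    using enum cards by metis
  \<comment> \<open>The \<open>i\<close>-th point of the line through the choice with indices
    \<open>(0, j, k)\<close>.\<close>
  define cell where "cell j k i = (\<alpha> i, \<beta> ((i + j) mod 3), \<gamma> ((i + k) mod 3))" for j k i
  let ?pal = "\<lambda>(a, b, c). {a, b, c}"
  define P where "P = (\<lambda>(j, k). (\<lambda>i. ?pal (cell j k i)) ` {..<3})"
  have \<alpha>\<beta>\<gamma>: "\<alpha> i \<in> A" "\<beta> i \<in> B" "\<gamma> i \<in> C" if "i < 3" for i
    using bij that by (auto simp: bij_betw_def)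
  have "\<exists>i \<in> {..<3} \<times> {..<3}. P i \<inter> F = {}"
  proof (rule exists_unblocked_line)
    show "card F < card ({..<3::nat} \<times> {..<3::nat})" using F(3) by simp
    fix s t :: "nat \<times> nat" assume st: "s \<in> {..<3} \<times> {..<3}" "t \<in> {..<3} \<times> {..<3}" "s \<noteq> t"
    show "P s \<inter> P t \<inter> F = {}"
    proof (rule equals0I)
      fix S assume S: "S \<in> P s \<inter> P t \<inter> F"
      obtain j k j' k' where jk: "s = (j, k)" "t = (j', k')" by (metis prod.exhaust)
      with S obtain i i' where i: "i < 3" "i' < 3" and
        e: "S = {\<alpha> i, \<beta> ((i + j) mod 3), \<gamma> ((i + k) mod 3)}"
           "S = {\<alpha> i', \<beta> ((i' + j') mod 3), \<gamma> ((i' + k') mod 3)}"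
        by (auto simp: P_def cell_def)
      \<comment> \<open>Being a list, \<open>S\<close> has no repetition, so
        \<open>palette_unique\<close> recovers the point and with it the line.\<close>
      have "S \<in> F" using S by blast
      then have ne: "\<alpha> i \<noteq> \<beta> ((i + j) mod 3)" "\<alpha> i \<noteq> \<gamma> ((i + k) mod 3)"
        "\<beta> ((i + j) mod 3) \<noteq> \<gamma> ((i + k) mod 3)"
        using repeated_notin(1)[OF F(2)] unfolding e(1) by blast+
      have "\<alpha> i = \<alpha> i' \<and> \<beta> ((i + j) mod 3) = \<beta> ((i' + j') mod 3)
          \<and> \<gamma> ((i + k) mod 3) = \<gamma> ((i' + k') mod 3)"
        by (rule palette_unique[of _ A _ B _ C])
          (use i \<alpha>\<beta>\<gamma> e ne AB AC BC in \<open>simp_all\<close>)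
      then have "i = i'" "(i + j) mod 3 = (i' + j') mod 3" "(i + k) mod 3 = (i' + k') mod 3"
        using bij i by (auto simp: bij_betw_def inj_on_def)
      then have "(i + j) mod 3 = (i + j') mod 3" "(i + k) mod 3 = (i + k') mod 3" by simp_all
      moreover have "j < 3" "k < 3" "j' < 3" "k' < 3" using st jk by auto
      ultimately have "j = j'" "k = k'" using i(1) add_mod3 by blast+
      with jk st(3) show False by simp
    qed
  qed (fact F(1))
  then obtain j k where jk: "j < 3" "k < 3" "P (j, k) \<inter> F = {}" by auto
  have notin: "{\<alpha> i, \<beta> ((i + j) mod 3), \<gamma> ((i + k) mod 3)} \<notin> F" if "i < 3" for i
  proof -
    have "?pal (cell j k i) \<in> P (j, k)" using that by (simp add: P_def)
    with jk(3) show ?thesis unfolding cell_def by auto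
  qed
  have three: "{..<3::nat} = {0, 1, 2}" by auto
  \<comment> \<open>A line runs through every color of each list, as \<open>covered3_latin\<close>
    requires.\<close>
  have rot: "(\<lambda>i. (i + j) mod 3) ` {..<3} = {..<3::nat}" if "j < 3" for j
  proof -
    have "j \<in> {0, 1, 2}" using that by auto
    then show ?thesis unfolding three by auto
  qed
  have "A = {\<alpha> 0, \<alpha> 1, \<alpha> 2}" using bij(1) by (simp add: bij_betw_def three)
  moreover have "B = \<beta> ` (\<lambda>i. (i + j) mod 3) ` {..<3}" "C = \<gamma> ` (\<lambda>i. (i + k) mod 3) ` {..<3}"
    using bij(2,3) rot[OF jk(1)] rot[OF jk(2)] by (simp_all add: bij_betw_def)
  then have "B = {\<beta> ((0 + j) mod 3), \<beta> ((1 + j) mod 3), \<beta> ((2 + j) mod 3)}"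
    "C = {\<gamma> ((0 + k) mod 3), \<gamma> ((1 + k) mod 3), \<gamma> ((2 + k) mod 3)}"
    unfolding three by (simp_all only: image_insert image_empty)
  ultimately show ?thesis
    by (rule covered3_latin[OF _ cards(1) _ cards(2) _ cards(3) _ mem])
      (use BC notin[of 0] notin[of 1] notin[of 2] in auto)
qed


section \<open>Three colorings when a color \<open>t\<close> lies in all three lists\<close>

text \<open>Two colorings with repetitions meet all requests and have only \<open>t\<close> in
  common; the free choice \<open>(a, b, c)\<close> avoids \<open>t\<close>. If \<open>y = z\<close>,
  the pair \<open>(t, y, t)\<close>, \<open>(t, t, z)\<close> would also share \<open>y\<close>,
  whence the case distinction.\<close>

lemma covered3_common_requested:
  assumes F: "finite F" "\<forall>S \<in> F. card S = 3"
    and mem: "t \<in> A" "t \<in> B" "t \<in> C" "y \<in> B" "z \<in> C"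
    and g: "a \<in> A" "b \<in> B" "c \<in> C" "t \<notin> {a, b, c}" "{a, b, c} \<notin> F"
  shows "covered F A B C t y z 3"
proof (cases "y = z")
  case True
  with g mem show ?thesis
    by (intro covered3I[of t A z B z C F t t t a b c]) (use repeated_notin[OF F(2)] in auto)
next
  case False
  with g mem show ?thesis
    by (intro covered3I[of t A y B t C F t t z a b c]) (use repeated_notin[OF F(2)] in auto)
qed

lemma covered3_common_equal:
  assumes F: "finite F" "\<forall>S \<in> F. card S = 3"
    and mem: "t \<in> A" "t \<in> B" "t \<in> C" "x \<in> A" "x \<in> B" "z \<in> C"
    and g: "a \<in> A" "b \<in> B" "c \<in> C" "t \<notin> {a, b, c}" "{a, b, c} \<notin> F"
  shows "covered F A B C x x z 3"
proof (cases "x = z")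
  case True
  with g mem show ?thesis
    by (intro covered3I[of x A x B x C F t t t a b c]) (use repeated_notin[OF F(2)] in auto)
next
  case False
  with g mem show ?thesis
    by (intro covered3I[of x A x B t C F t t z a b c]) (use repeated_notin[OF F(2)] in auto)
qed

text \<open>The free coloring meets \<open>x\<close> itself, and \<open>(t, y, t)\<close>,
  \<open>(t, t, z)\<close> meet the other requests while sharing only \<open>t\<close>.\<close>

lemma covered3_common_hit:
  assumes F: "finite F" "\<forall>S \<in> F. card S = 3"
    and mem: "t \<in> A" "t \<in> B" "t \<in> C" "y \<in> B" "z \<in> C" and "y \<noteq> z"
    and g: "x \<in> A" "b \<in> B" "c \<in> C" "t \<notin> {x, b, c}" "{x, b, c} \<notin> F"
  shows "covered F A B C x y z 3"
  using g mem \<open>y \<noteq> z\<close>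
  by (intro covered3I[of x A b B c C F t y t t t z]) (use repeated_notin[OF F(2)] in auto)

text \<open>
  If the seven choices that avoid \<open>t\<close> and meet some request were all blocked, and also
  \<open>{x, y, t}\<close> and \<open>{x, t, z}\<close>, then there would be nine lists.
\<close>

lemma covered3_common_distinct:
  assumes F: "finite F" "\<forall>S \<in> F. card S = 3" "card F \<le> 8" and "t \<in> \<Union>F"
    and cards: "card A = 3" "card B = 3" "card C = 3"
    and mem: "x \<in> A" "y \<in> B" "z \<in> C" and t: "t \<in> A" "t \<in> B" "t \<in> C"
    and ne: "x \<noteq> y" "x \<noteq> z" "y \<noteq> z" "x \<noteq> t" "y \<noteq> t" "z \<noteq> t"
    and g: "a \<in> A" "b \<in> B" "c \<in> C" "t \<notin> {a, b, c}" "{a, b, c} \<notin> F"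
  shows "covered F A B C x y z 3"
proof -
  note good = repeated_notin[OF F(2)]
  note hit = covered3_common_hit[OF F(1,2)]
  have x: "covered F A B C x y z 3"
    if "q \<in> B" "r \<in> C" "t \<notin> {x, q, r}" "{x, q, r} \<notin> F" for q r
    using hit[of t A B C y z x q r] that mem t ne by blast
  have y: "covered F A B C x y z 3"
    if "p \<in> A" "r \<in> C" "t \<notin> {p, y, r}" "{p, y, r} \<notin> F" for p r
    by (rule covered_swap12, rule hit[of t B A C x z y p r])
      (use that mem t ne in \<open>auto simp: insert_commute\<close>)
  have z: "covered F A B C x y z 3"
    if "p \<in> A" "q \<in> B" "t \<notin> {p, q, z}" "{p, q, z} \<notin> F" for p q
    by (rule covered_swap23, rule covered_swap12, rule hit[of t C A B x y z p q])
      (use that mem t ne in \<open>auto simp: insert_commute\<close>)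
  show ?thesis
  proof (cases "\<exists>p \<in> A. \<exists>q \<in> B. \<exists>r \<in> C. t \<notin> {p, q, r} \<and> {p, q, r} \<notin> F \<and> (p = x \<or> q = y \<or> r = z)")
    case True
    then show ?thesis using x y z by blast
  next
    case False
    then have bl: "{p, q, r} \<in> F"
      if "p \<in> A" "q \<in> B" "r \<in> C" "t \<notin> {p, q, r}" "p = x \<or> q = y \<or> r = z" for p q r
      using that by blast
    \<comment> \<open>Otherwise \<open>(a, b, c)\<close> would itself be a free choice that avoids
      \<open>t\<close> and meets a request.\<close>
    have abc: "a \<noteq> x" "b \<noteq> y" "c \<noteq> z" using bl[OF g(1-4)] g(5) by blast+
    \<comment> \<open>Completed by a request, the pair becomes a blocked choice, and blocked choices
      have no repetition.\<close>
    have "p \<noteq> q" if "p \<in> {x, a}" "q \<in> {y, b}" for p q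
      using bl[of p q z] that mem g(1-4) ne good(1)[of p q z] by auto
    moreover have "p \<noteq> r" if "p \<in> {x, a}" "r \<in> {z, c}" for p r
      using bl[of p y r] that mem g(1-4) ne good(1)[of p y r] by auto
    moreover have "q \<noteq> r" if "q \<in> {y, b}" "r \<in> {z, c}" for q r
      using bl[of x q r] that mem g(1-4) ne good(1)[of x q r] by auto
    ultimately have disj: "{x, a} \<inter> {y, b} = {}" "{x, a} \<inter> {z, c} = {}" "{y, b} \<inter> {z, c} = {}"
      by blast+
    have "{x, y, t} \<notin> F \<or> {x, t, z} \<notin> F"
    proof (rule ccontr)
      assume "\<not> ?thesis"
      then have both: "{{x, y, t}, {x, t, z}} \<subseteq> {S \<in> F. t \<in> S}" by blast
      have "y \<notin> {x, t, z}" using ne by auto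
      then have "{x, y, t} \<noteq> {x, t, z}" by blast
      then have "card {{x, y, t}, {x, t, z}} = 2" by simp
      with card_mono[OF _ both] F(1) have 2: "2 \<le> card {S \<in> F. t \<in> S}" by simp
      let ?p = "\<lambda>(a, b, c). {a, b, c}"
      \<comment> \<open>The subcube without the one corner that meets no request: seven lists
        without \<open>t\<close>, besides the two with \<open>t\<close>.\<close>
      let ?W = "{x, a} \<times> {y, b} \<times> {z, c} - {(a, b, c)}"
      have "inj_on ?p ?W"
        using inj_on_palette[OF disj] by (rule inj_on_subset) blast
      then have "card (?p ` ?W) = card ?W" by (rule card_image)
      also have "\<dots> = 7"
        using abc by (simp add: card_Diff_singleton_if card_cartesian_product)
      moreover have "?p ` ?W \<subseteq> {S \<in> F. t \<notin> S}"
        using bl mem g(1-4) ne by auto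
      then have "card (?p ` ?W) \<le> card {S \<in> F. t \<notin> S}"
        using F(1) by (intro card_mono) simp_all
      ultimately have 7: "7 \<le> card {S \<in> F. t \<notin> S}" by simp
      have "F = {S \<in> F. t \<in> S} \<union> {S \<in> F. t \<notin> S}" by blast
      moreover have "card ({S \<in> F. t \<in> S} \<union> {S \<in> F. t \<notin> S})
          = card {S \<in> F. t \<in> S} + card {S \<in> F. t \<notin> S}"
        using F(1) by (intro card_Un_disjoint) auto
      ultimately have "card F = card {S \<in> F. t \<in> S} + card {S \<in> F. t \<notin> S}" by simp
      with 2 7 F(3) show False by simp
    qed
    then show ?thesis
    proof
      assume "{x, y, t} \<notin> F"
      then show ?thesis
        using mem t ne g good by (intro covered3I[of x A y B t C F t t z a b c]) auto
    next
      assume "{x, t, z} \<notin> F"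
      then show ?thesis
        using mem t ne g good by (intro covered3I[of x A t B z C F t y t a b c]) auto
    qed
  qed
qed

text \<open>If \<open>t\<close> is in no list of \<open>F\<close>, palettes with \<open>t\<close>
  are never blocked and \<open>t\<close> may be common to all three. Otherwise at most seven lists
  avoid \<open>t\<close>, so one of the eight choices avoiding \<open>t\<close> is free and serves
  to eliminate \<open>t\<close>.\<close>

lemma covered3_common:
  assumes F: "finite F" "\<forall>S \<in> F. card S = 3" "card F \<le> 8"
    and cards: "card A = 3" "card B = 3" "card C = 3"
    and mem: "x \<in> A" "y \<in> B" "z \<in> C" and t: "t \<in> A" "t \<in> B" "t \<in> C"
  shows "covered F A B C x y z 3"
proof (cases "t \<in> \<Union>F")
  case False
  note good = repeated_notin[OF F(2)]
  show ?thesis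
  proof (cases "x = y \<and> y = z")
    case True
    with False mem t show ?thesis
      by (intro covered3I[of x A x B x C F t t t t t t]) (use good in auto)
  next
    case ne: False
    have "{x, t, t} \<inter> {t, y, t} \<inter> {t, t, z} \<inter> \<Union>F = {}"
      using False ne by blast
    with mem t show ?thesis
      by (intro covered3I[of x A t B t C F t y t t t z]) (use good in \<open>auto simp: insert_commute\<close>)
  qed
next
  case True
  have "card {S \<in> F. t \<notin> S} < card F"
    using True F(1) by (intro psubset_card_mono) auto
  then have "card {S \<in> F. t \<notin> S} < card (A - {t}) * card (B - {t}) * card (C - {t})"
    using cards t F(3) by (simp add: card_Diff_singleton_if)
  then obtain a b c where abc: "a \<in> A - {t}" "b \<in> B - {t}" "c \<in> C - {t}"
    "{a, b, c} \<notin> {S \<in> F. t \<notin> S}"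
    using exists_unblocked[of "{S \<in> F. t \<notin> S}" "A - {t}" "B - {t}" "C - {t}"] F(1,2) by auto
  then have g: "a \<in> A" "b \<in> B" "c \<in> C" "t \<notin> {a, b, c}" "{a, b, c} \<notin> F"
    by auto
  note sym = insert_commute
  note req = covered3_common_requested[OF F(1,2)] and eq = covered3_common_equal[OF F(1,2)]
  consider "x = t" | "y = t" | "z = t" | "x = y" | "x = z" | "y = z"
    | "x \<noteq> y" "x \<noteq> z" "y \<noteq> z" "x \<noteq> t" "y \<noteq> t" "z \<noteq> t" by blast
  then show ?thesis
  proof cases
    case 1
    have "covered F A B C t y z 3" by (rule req[OF t mem(2,3) g])
    with 1 show ?thesis by simp
  next
    case 2
    have "covered F B A C t x z 3"
      by (rule req[of t B A C x z b a c]) (use mem t g in \<open>auto simp: sym\<close>)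
    with 2 show ?thesis by (simp add: covered_swap12)
  next
    case 3
    have "covered F C A B t x y 3"
      by (rule req[of t C A B x y c a b]) (use mem t g in \<open>auto simp: sym\<close>)
    from covered_swap23[OF covered_swap12[OF this]] 3 show ?thesis by simp
  next
    case 4
    have "covered F A B C x x z 3"
      by (rule eq[OF t mem(1) _ mem(3) g]) (use 4 mem(2) in simp)
    with 4 show ?thesis by simp
  next
    case 5
    have "covered F A C B x x y 3"
      by (rule eq[of t A C B x y a c b]) (use 5 mem t g in \<open>auto simp: sym\<close>)
    from covered_swap23[OF this] 5 show ?thesis by simp
  next
    case 6
    have "covered F B C A y y x 3"
      by (rule eq[of t B C A y x b c a]) (use 6 mem t g in \<open>auto simp: sym\<close>)
    from covered_swap12[OF covered_swap23[OF this]] 6 show ?thesis by simp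
  next
    case 7
    show ?thesis
      by (rule covered3_common_distinct[OF F True cards mem t 7 g])
  qed
qed

text \<open>Either a color is common to all lists, or two lists are disjoint (moved to the places of
  \<open>B\<close> and \<open>C\<close> by swaps), or the lists meet pairwise only.\<close>

lemma covered3:
  assumes F: "finite F" "\<forall>S \<in> F. card S = 3" "card F \<le> 8"
    and cards: "card A = 3" "card B = 3" "card C = 3"
    and mem: "x \<in> A" "y \<in> B" "z \<in> C"
  shows "covered F A B C x y z 3"
proof -
  have BC: "covered F A B C x y z 3"
    if "card A = 3" "card B = 3" "card C = 3" "x \<in> A" "y \<in> B" "z \<in> C" "B \<inter> C = {}"
    for A B C x y z
  proof (cases "\<exists>p q. p \<in> A \<inter> B \<and> q \<in> A \<inter> B \<and> p \<noteq> q")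
    case True
    then show ?thesis using covered3_double[OF F that] by blast
  next
    case AB: False
    show ?thesis
    proof (cases "\<exists>p q. p \<in> A \<inter> C \<and> q \<in> A \<inter> C \<and> p \<noteq> q")
      case True
      have "C \<inter> B = {}" using that(7) by blast
      then have "covered F A C B x z y 3"
        using covered3_double[OF F that(1,3,2,4,6,5)] True by blast
      then show ?thesis by (rule covered_swap23)
    next
      case False
      with AB show ?thesis using covered3_sparse[OF F that(1-6) _ _ that(7)] by blast
    qed
  qed
  consider t where "t \<in> A" "t \<in> B" "t \<in> C" | "B \<inter> C = {}" | "A \<inter> C = {}" | "A \<inter> B = {}"
    | "A \<inter> B \<inter> C = {}" "A \<inter> B \<noteq> {}" "A \<inter> C \<noteq> {}" "B \<inter> C \<noteq> {}" by blast
  then show ?thesis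
  proof cases
    case 1
    then show ?thesis using covered3_common[OF F cards mem] by blast
  next
    case 2
    then show ?thesis using BC[OF cards mem] by blast
  next
    case 3
    then show ?thesis by (intro covered_swap12[OF BC[OF cards(2,1,3) mem(2,1,3)]])
  next
    case 4
    then show ?thesis
      by (intro covered_swap23[OF covered_swap12[OF BC[OF cards(3,1,2) mem(3,1,2)]]])
  next
    case 5
    then show ?thesis using covered3_triangle[OF F(2) cards mem] by blast
  qed
qed

subsection \<open>Flexibility of complete bipartite graphs\<close>

locale complete_bipartite_parts =
  fixes G :: "('a, 'b) pre_digraph" and U V :: "'a set"
  assumes verts: "verts G = U \<union> V" and disjoint: "U \<inter> V = {}"
    and arcs: "arcs_ends G = U \<times> V \<union> V \<times> U"
    and finite: "finite U" "finite V" and nonempty: "U \<noteq> {}" "V \<noteq> {}"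
begin

section \<open>Extension of colorings and lower bounds\<close>

lemma proper_list_coloring_extend:
  assumes "\<And>u. u \<in> U \<Longrightarrow> g u \<in> L u" "\<And>v. v \<in> V \<Longrightarrow> f v \<in> L v - g ` U"
  shows "proper_list_coloring G L (\<lambda>w. if w \<in> U then g w else f w)"
  unfolding proper_list_coloring_def verts arcs
proof (intro conjI ballI)
  show "(if w \<in> U then g w else f w) \<in> L w" if "w \<in> U \<union> V" for w
    using that assms(1)[of w] assms(2)[of w] by auto
  have V: "v \<notin> U" if "v \<in> V" for v using that disjoint by blast
  have "f v \<noteq> g u" if "u \<in> U" "v \<in> V" for u v
    using assms(2)[OF that(2)] that(1) by auto
  then show "case e of (u, v) \<Rightarrow> (if u \<in> U then g u else f u) \<noteq> (if v \<in> U then g v else f v)"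
    if "e \<in> U \<times> V \<union> V \<times> U" for e
    using that V by (auto simp: eq_commute)
qed

text \<open>By averaging, one of the \<open>k\<close> colorings meets at least a \<open>1/k\<close> fraction of the request.\<close>

lemma flexibleI:
  assumes "k > 0" "t > 0"
    and cover: "\<And>L r. list_assignment G t L \<Longrightarrow> (\<And>u. u \<in> U \<Longrightarrow> r u \<in> L u) \<Longrightarrow>
      \<exists>g. (\<forall>i<k. (\<forall>u \<in> U. g i u \<in> L u) \<and> (\<forall>v \<in> V. \<not> L v \<subseteq> g i ` U))
        \<and> (\<forall>u \<in> U. \<exists>i<k. g i u = r u) \<and> (\<forall>v \<in> V. \<forall>p \<in> L v. \<exists>i<k. p \<notin> g i ` U)"
  shows "flexible G t (1 / real k)"
  unfolding flexible_def
proof (intro allI impI)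
  fix L :: "'a \<Rightarrow> nat set" and r :: "'a \<rightharpoonup> nat"
  assume L: "list_assignment G t L" and r: "list_request G L r"
  \<comment> \<open>Vertices without a request get an arbitrary color of their list, so that the
    request on \<open>U\<close> becomes total.\<close>
  define r' where "r' u = (case r u of None \<Rightarrow> SOME p. p \<in> L u | Some p \<Rightarrow> p)" for u
  have ne: "L u \<noteq> {}" if "u \<in> verts G" for u
    using L that \<open>t > 0\<close> by (auto simp: list_assignment_def)
  have r_in: "p \<in> L v" if "r v = Some p" for v p
    using r that unfolding list_request_def by (metis domI option.sel)
  have "r' u \<in> L u" if "u \<in> U" for u
    using that ne[of u] r_in[of u] unfolding r'_def
    by (cases "r u") (auto simp: verts some_in_eq)
  then obtain g where g: "\<And>i u. i < k \<Longrightarrow> u \<in> U \<Longrightarrow> g i u \<in> L u"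
    "\<And>i v. i < k \<Longrightarrow> v \<in> V \<Longrightarrow> \<not> L v \<subseteq> g i ` U"
    "\<And>u. u \<in> U \<Longrightarrow> \<exists>i<k. g i u = r' u"
    "\<And>v p. v \<in> V \<Longrightarrow> p \<in> L v \<Longrightarrow> \<exists>i<k. p \<notin> g i ` U"
    using cover[OF L, of r'] by metis
  \<comment> \<open>The request is granted whenever the palette of the \<open>i\<close>-th coloring
    allows it; otherwise any free color of the list is taken.\<close>
  define h where "h i v = (if \<exists>p. r v = Some p \<and> p \<notin> g i ` U then the (r v)
    else SOME p. p \<in> L v - g i ` U)" for i v
  define f where "f i w = (if w \<in> U then g i w else h i w)" for i w
  have h: "h i v \<in> L v - g i ` U" if "i < k" "v \<in> V" for i v
  proof (cases "\<exists>p. r v = Some p \<and> p \<notin> g i ` U")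
    case True
    then show ?thesis using r_in by (auto simp: h_def)
  next
    case False
    have "\<exists>p. p \<in> L v - g i ` U" using g(2)[OF that] by blast
    then have "(SOME p. p \<in> L v - g i ` U) \<in> L v - g i ` U" by (rule someI_ex)
    moreover have "h i v = (SOME p. p \<in> L v - g i ` U)" using False by (simp only: h_def if_False)
    ultimately show ?thesis by simp
  qed
  have proper: "proper_list_coloring G L (f i)" if "i < k" for i
    unfolding f_def using that g(1) h by (intro proper_list_coloring_extend) auto
  have fin: "finite (dom r)" and ne_dom: "dom r \<noteq> {}" and dom: "dom r \<subseteq> verts G"
    using r finite verts by (auto simp: list_request_def intro: finite_subset)
  let ?S = "\<lambda>i. {v \<in> dom r. r v = Some (f i v)}"
  have "dom r \<subseteq> (\<Union>i<k. ?S i)"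
  proof
    fix v assume v: "v \<in> dom r"
    then obtain p where p: "r v = Some p" by blast
    have "\<exists>i<k. f i v = p"
    proof (cases "v \<in> U")
      case True
      then show ?thesis using g(3)[OF True] p by (simp add: f_def r'_def)
    next
      case False
      then have "v \<in> V" using v dom verts by blast
      then obtain i where "i < k" "p \<notin> g i ` U" using g(4) r_in[OF p] by blast
      then show ?thesis using False p by (intro exI[of _ i]) (simp add: f_def h_def)
    qed
    then show "v \<in> (\<Union>i<k. ?S i)" using p v by auto
  qed
  then have "card (dom r) \<le> card (\<Union>i<k. ?S i)"
    using fin by (intro card_mono) auto
  also have "\<dots> \<le> (\<Sum>i<k. card (?S i))"
    by (rule card_UN_le) simp
  finally have le: "card (dom r) \<le> (\<Sum>i<k. card (?S i))" .
  have "\<exists>i<k. card (dom r) \<le> k * card (?S i)"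
  proof (rule ccontr)
    assume "\<not> ?thesis"
    then have "k * card (?S i) < card (dom r)" if "i < k" for i
      using that by (simp add: not_le)
    then have "(\<Sum>i<k. k * card (?S i)) < (\<Sum>i<k. card (dom r))"
      using \<open>k > 0\<close> by (intro sum_strict_mono) auto
    then have "k * (\<Sum>i<k. card (?S i)) < k * card (dom r)"
      by (simp add: sum_distrib_left)
    with le show False by simp
  qed
  then obtain i where i: "i < k" "card (dom r) \<le> k * card (?S i)" by blast
  then have "real (card (dom r)) \<le> real k * real (card (?S i))"
    by (metis of_nat_le_iff of_nat_mult)
  then have "1 / real k * real (card (dom r)) \<le> real (card (?S i))"
    using \<open>k > 0\<close> by (simp add: field_simps)
  with proper[OF i(1)] show "satisfiable_request (1 / real k) G L r"
    unfolding satisfiable_request_def by blast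
qed

text \<open>A palette has at most \<open>card U\<close> colors and so contains no list. This makes
  every coloring of \<open>U\<close> extendable, and it also gives each vertex of \<open>U\<close> a
  color outside the palette of the request.\<close>

lemma flexible_half_large_lists:
  assumes "card U < t"
  shows "flexible G t (1 / 2)"
proof -
  have "flexible G t (1 / real 2)"
  proof (rule flexibleI)
    fix L :: "'a \<Rightarrow> nat set" and r
    assume L: "list_assignment G t L" and r: "\<And>u. u \<in> U \<Longrightarrow> r u \<in> L u"
    have not_sub: "\<not> L w \<subseteq> g ` U" if "w \<in> U \<union> V" for w and g :: "'a \<Rightarrow> nat"
    proof
      assume "L w \<subseteq> g ` U"
      then have "card (L w) \<le> card (g ` U)" using finite by (intro card_mono) auto
      also have "\<dots> \<le> card U" using finite by (intro card_image_le)
      finally show False using L that assms by (auto simp: list_assignment_def verts)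
    qed
    have "\<exists>p. p \<in> L u \<and> p \<notin> r ` U" if "u \<in> U" for u
      using not_sub[of u r] that by blast
    then obtain s where s: "\<And>u. u \<in> U \<Longrightarrow> s u \<in> L u \<and> s u \<notin> r ` U" by metis
    show "\<exists>g. (\<forall>i<2::nat. (\<forall>u \<in> U. g i u \<in> L u) \<and> (\<forall>v \<in> V. \<not> L v \<subseteq> g i ` U))
        \<and> (\<forall>u \<in> U. \<exists>i<2::nat. g i u = r u) \<and> (\<forall>v \<in> V. \<forall>p \<in> L v. \<exists>i<2::nat. p \<notin> g i ` U)"
    proof (intro exI[of _ "\<lambda>i::nat. if i = 0 then r else s"] conjI allI ballI impI)
      fix p
      show "\<exists>i<2::nat. p \<notin> (if i = 0 then r else s) ` U" for p
        using s by (cases "p \<in> r ` U") (intro exI[of _ 1], force, intro exI[of _ 0], force)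
    qed (use r s not_sub in auto)
  qed (use assms in auto)
  then show ?thesis by simp
qed

text \<open>A list of size 3 contained in a palette equals it, so it suffices that palettes are not
  lists.\<close>

lemma flexible_covered:
  assumes "U = {u, v, w}" "distinct [u, v, w]" "k > 0"
    and cover: "\<And>L r. list_assignment G 3 L \<Longrightarrow> (\<And>u. u \<in> U \<Longrightarrow> r u \<in> L u) \<Longrightarrow>
      covered (L ` V) (L u) (L v) (L w) (r u) (r v) (r w) k"
  shows "flexible G 3 (1 / real k)"
proof (rule flexibleI)
  fix L :: "'a \<Rightarrow> nat set" and r
  assume L: "list_assignment G 3 L" and r: "\<And>u. u \<in> U \<Longrightarrow> r u \<in> L u"
  have "covered (L ` V) (L u) (L v) (L w) (r u) (r v) (r w) k" using L r by (rule cover)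
  then obtain fs where fs: "length fs = k"
    "\<forall>(a, b, c) \<in> set fs. a \<in> L u \<and> b \<in> L v \<and> c \<in> L w \<and> {a, b, c} \<notin> L ` V"
    "\<exists>(a, b, c) \<in> set fs. a = r u" "\<exists>(a, b, c) \<in> set fs. b = r v" "\<exists>(a, b, c) \<in> set fs. c = r w"
    "\<forall>p \<in> \<Union>(L ` V). \<exists>(a, b, c) \<in> set fs. p \<notin> {a, b, c}"
    unfolding covered_def by (elim exE conjE) (rule that)
  define g where "g i x = (if x = u then fst (fs ! i) else if x = v then fst (snd (fs ! i))
    else snd (snd (fs ! i)))" for i x
  have img: "g i ` U = {fst (fs ! i), fst (snd (fs ! i)), snd (snd (fs ! i))}" for i
    using assms(1,2) by (auto simp: g_def)
  have nth: "\<exists>i<k. P (fs ! i)" if "\<exists>e \<in> set fs. P e" for P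
    using that fs(1) by (metis in_set_conv_nth)
  have mem: "fs ! i \<in> set fs" if "i < k" for i using that fs(1) by simp
  show "\<exists>g. (\<forall>i<k. (\<forall>u \<in> U. g i u \<in> L u) \<and> (\<forall>v \<in> V. \<not> L v \<subseteq> g i ` U))
        \<and> (\<forall>u \<in> U. \<exists>i<k. g i u = r u) \<and> (\<forall>v \<in> V. \<forall>p \<in> L v. \<exists>i<k. p \<notin> g i ` U)"
  proof (intro exI[of _ g] conjI allI ballI impI)
    fix i x assume "i < k" "x \<in> U"
    with bspec[OF fs(2) mem[of i]] assms(1) show "g i x \<in> L x"
      by (auto simp: g_def case_prod_unfold)
  next
    fix i x assume ix: "i < k" "x \<in> V"
    show "\<not> L x \<subseteq> g i ` U"
    proof
      assume sub: "L x \<subseteq> g i ` U"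
      have "card (L x) = 3" using L ix(2) by (simp add: list_assignment_def verts)
      moreover have "card (g i ` U) \<le> 3"
        unfolding img by (simp add: card_insert_if)
      ultimately have "L x = g i ` U"
        using sub by (intro card_seteq) (simp_all add: finite)
      with ix(2) bspec[OF fs(2) mem[OF ix(1)]] show False
        unfolding img by (auto simp: case_prod_unfold)
    qed
  next
    fix x assume "x \<in> U"
    then consider "x = u" | "x = v" | "x = w" using assms(1) by blast
    then show "\<exists>i<k. g i x = r x"
      using nth[OF fs(3)] nth[OF fs(4)] nth[OF fs(5)] assms(2)
      by cases (auto simp: g_def case_prod_unfold)
  next
    fix x p assume "x \<in> V" "p \<in> L x"
    then show "\<exists>i<k. p \<notin> g i ` U"
      using nth[OF bspec[OF fs(6)]] unfolding img case_prod_unfold by blast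
  qed
qed (use assms in simp_all)

text \<open>There are 27 choices on \<open>U\<close> against at most 26 lists.\<close>

lemma three_choosable:
  assumes "card U = 3" "card V < 27" "list_assignment G 3 L"
  shows "\<exists>f. proper_list_coloring G L f"
proof -
  obtain u v w where U: "U = {u, v, w}" "u \<noteq> v" "u \<noteq> w" "v \<noteq> w"
    using assms(1) by (metis card_3_iff)
  have card3: "card (L x) = 3" if "x \<in> U \<union> V" for x
    using assms(3) that by (simp add: list_assignment_def verts)
  have "card (L ` V) < card (L u) * card (L v) * card (L w)"
    using card3 U(1) card_image_le[OF finite(2), of L] assms(2) by simp
  then obtain a b c where abc: "a \<in> L u" "b \<in> L v" "c \<in> L w" "{a, b, c} \<notin> L ` V"
    using exists_unblocked[of "L ` V" "L u" "L v" "L w"] card3 finite by blast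
  define g where "g x = (if x = u then a else if x = v then b else c)" for x
  have img: "g ` U = {a, b, c}" and g_in: "\<And>x. x \<in> U \<Longrightarrow> g x \<in> L x"
    using U abc by (auto simp: g_def)
  have "\<exists>p. p \<in> L x - g ` U" if "x \<in> V" for x
  proof (rule ccontr)
    assume "\<not> ?thesis"
    then have sub: "L x \<subseteq> {a, b, c}" using img by blast
    moreover have "card {a, b, c} \<le> 3" by (simp add: card_insert_if)
    ultimately have "L x = {a, b, c}"
      using card3[of x] that by (intro card_seteq) simp_all
    with abc(4) that show False by auto
  qed
  then obtain f where "\<And>x. x \<in> V \<Longrightarrow> f x \<in> L x - g ` U" by metis
  then show ?thesis
    using proper_list_coloring_extend[of g L f] g_in by blast
qed

text \<open>Serves to place \<open>t\<close> in the domain of the flexibility function. Flexibility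
  provides colorings only for nonempty requests, so a single vertex makes one.\<close>

lemma flexible_imp_choosable:
  assumes "flexible G t \<epsilon>" "t > 0" "list_assignment G t L"
  shows "\<exists>f. proper_list_coloring G L f"
proof -
  obtain u where u: "u \<in> U" using nonempty by blast
  then have "card (L u) = t" using assms(3) by (simp add: list_assignment_def verts)
  with assms(2) have "L u \<noteq> {}" by auto
  then obtain p where "p \<in> L u" by blast
  with u have "list_request G L [u \<mapsto> p]"
    by (simp add: list_request_def verts)
  with assms(1,3) show ?thesis
    unfolding flexible_def satisfiable_request_def by blast
qed

section \<open>Upper bounds\<close>

lemma flexible_le:
  assumes "flexible G t \<epsilon>" "list_assignment G t L" "list_request G L r"
    and "\<And>f. proper_list_coloring G L f \<Longrightarrow> card {v \<in> dom r. r v = Some (f v)} \<le> m"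
  shows "\<epsilon> * real (card (dom r)) \<le> real m"
proof -
  obtain f where "proper_list_coloring G L f"
    "\<epsilon> * real (card (dom r)) \<le> real (card {v \<in> dom r. r v = Some (f v)})"
    using assms(1-3) unfolding flexible_def satisfiable_request_def by blast
  with assms(4) show ?thesis by (meson of_nat_le_iff order_trans)
qed

text \<open>Two adjacent vertices request the same color.\<close>

lemma flexible_le_half:
  assumes "flexible G t \<epsilon>" "t > 0"
  shows "\<epsilon> \<le> 1 / 2"
proof -
  obtain u v where uv: "u \<in> U" "v \<in> V" using nonempty by blast
  then have "u \<noteq> v" using disjoint by blast
  let ?r = "[u \<mapsto> 0::nat, v \<mapsto> 0]"
  have "\<epsilon> * real (card (dom ?r)) \<le> real 1"
  proof (rule flexible_le[OF assms(1), of "\<lambda>_. {..<t}"])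
    show "list_assignment G t (\<lambda>_. {..<t})" by (simp add: list_assignment_def)
    show "list_request G (\<lambda>_. {..<t}) ?r" using uv assms(2) by (auto simp: list_request_def verts)
    fix f assume f: "proper_list_coloring G (\<lambda>_. {..<t}) f"
    then have "f u \<noteq> f v" using uv by (auto simp: proper_list_coloring_def arcs)
    then have "{x \<in> dom ?r. ?r x = Some (f x)} \<subseteq> {if f u = 0 then u else v}" by auto
    from card_mono[OF _ this] show "card {x \<in> dom ?r. ?r x = Some (f x)} \<le> 1" by simp
  qed
  with \<open>u \<noteq> v\<close> show ?thesis by simp
qed

text \<open>Each palette in \<open>P\<close> becomes the list of some vertex of \<open>V\<close>,
  which could not be colored if \<open>U\<close> used exactly this palette.\<close>

lemma blocking_assignment:
  assumes U: "U = {u, v, w}" "distinct [u, v, w]"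
    and P: "finite P" "P \<noteq> {}" "card P \<le> card V" "\<And>S. S \<in> P \<Longrightarrow> card S = 3"
    and cards: "card A = 3" "card B = 3" "card C = 3"
  obtains L where "list_assignment G 3 L" "L u = A" "L v = B" "L w = C"
    "\<And>f. proper_list_coloring G L f \<Longrightarrow> {f u, f v, f w} \<notin> P"
proof -
  obtain j where j: "inj_on j P" "j ` P \<subseteq> V"
    using card_le_inj[OF P(1) finite(2) P(3)] by blast
  obtain S0 where "S0 \<in> P" using P(2) by blast
  \<comment> \<open>The vertices of \<open>V\<close> left over repeat the list
    \<open>S0\<close>.\<close>
  define h where "h x = (if x \<in> j ` P then inv_into P j x else S0)" for x
  define L where "L x = (if x = u then A else if x = v then B else if x = w then C else h x)" for x
  have h: "h x \<in> P" for x
    using \<open>S0 \<in> P\<close> by (simp add: h_def inv_into_into)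
  have L_V: "L x = h x" if "x \<in> V" for x
    using that disjoint U(1) by (auto simp: L_def)
  show thesis
  proof (rule that)
    have "card (L x) = 3" for x using cards h P(4) by (simp add: L_def)
    then show "list_assignment G 3 L"
      unfolding list_assignment_def by (metis card.infinite zero_neq_numeral)
    show "L u = A" "L v = B" "L w = C" using U(2) by (auto simp: L_def)
    fix f assume f: "proper_list_coloring G L f"
    show "{f u, f v, f w} \<notin> P"
    proof
      assume S: "{f u, f v, f w} \<in> P"
      define x where "x = j {f u, f v, f w}"
      have x: "x \<in> V" using S j(2) by (auto simp: x_def)
      have "h x = {f u, f v, f w}" using S j(1) by (simp add: h_def x_def)
      moreover have "f x \<in> L x" using f x by (simp add: proper_list_coloring_def verts)
      moreover have "f y \<noteq> f x" if "y \<in> U" for y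
        using f x that by (auto simp: proper_list_coloring_def arcs)
      ultimately have "f x \<in> {f u, f v, f w}" "f u \<noteq> f x" "f v \<noteq> f x" "f w \<noteq> f x"
        using L_V[OF x] U(1) by simp_all
      then show False by auto
    qed
  qed
qed

text \<open>The seven lists are the palettes with at least two of the requested colors 0, 3, 6, so
  any coloring meets at most one of the three requests.\<close>

lemma flexible_le_third:
  assumes "flexible G 3 \<epsilon>" "card U = 3" "card V \<ge> 7"
  shows "\<epsilon> \<le> 1 / 3"
proof -
  obtain u v w where U: "U = {u, v, w}" "distinct [u, v, w]"
    using assms(2) by (auto simp: card_3_iff)
  define P :: "nat set set" where
    "P = {{0, 3, 6}, {0, 3, 7}, {0, 3, 8}, {0, 4, 6}, {0, 5, 6}, {1, 3, 6}, {2, 3, 6}}"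
  define ps where "ps = [{0, 3, 6}, {0, 3, 7}, {0, 3, 8}, {0, 4, 6}, {0, 5, 6}, {1, 3, 6}, {2, 3, 6::nat}]"
  have "P = set ps" "length ps = 7" by (simp_all add: P_def ps_def)
  then have "card P \<le> 7" using card_length[of ps] by simp
  obtain L where L: "list_assignment G 3 L" "L u = {0, 1, 2}" "L v = {3, 4, 5}" "L w = {6, 7, 8}"
    "\<And>f. proper_list_coloring G L f \<Longrightarrow> {f u, f v, f w} \<notin> P"
    by (rule blocking_assignment[OF U, of P "{0, 1, 2}" "{3, 4, 5}" "{6, 7, 8}"])
      (use \<open>card P \<le> 7\<close> assms(3) in \<open>auto simp: P_def\<close>)
  let ?r = "[u \<mapsto> 0::nat, v \<mapsto> 3, w \<mapsto> 6]"
  have "\<epsilon> * real (card (dom ?r)) \<le> real 1"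
  proof (rule flexible_le[OF assms(1) L(1)])
    show "list_request G L ?r" using U L by (auto simp: list_request_def verts)
    fix f assume f: "proper_list_coloring G L f"
    then have in_L: "f u \<in> {0, 1, 2}" "f v \<in> {3, 4, 5}" "f w \<in> {6, 7, 8}"
      using L(2-4) U(1) unfolding proper_list_coloring_def verts by blast+
    have "{0, 3, f w} \<in> P" using in_L(3) unfolding P_def by (elim insertE emptyE) simp_all
    moreover have "{0, f v, 6} \<in> P" using in_L(2) unfolding P_def by (elim insertE emptyE) simp_all
    moreover have "{f u, 3, 6} \<in> P" using in_L(1) unfolding P_def by (elim insertE emptyE) simp_all
    ultimately have "\<not> (f u = 0 \<and> f v = 3)" "\<not> (f u = 0 \<and> f w = 6)" "\<not> (f v = 3 \<and> f w = 6)"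
      using L(5)[OF f] by metis+
    then have "{x \<in> dom ?r. ?r x = Some (f x)} \<subseteq> {if f u = 0 then u else if f v = 3 then v else w}"
      by (auto split: if_splits)
    from card_mono[OF _ this] show "card {x \<in> dom ?r. ?r x = Some (f x)} \<le> 1" by simp
  qed
  moreover have "card (dom ?r) = 3" using U(2) by (auto simp: card_insert_if)
  ultimately show ?thesis by simp
qed

text \<open>The nine lists are all palettes that use color 0, the only request, at
  \<open>u\<close>.\<close>

lemma flexible_le_zero:
  assumes "flexible G 3 \<epsilon>" "card U = 3" "card V \<ge> 9"
  shows "\<epsilon> \<le> 0"
proof -
  obtain u v w where U: "U = {u, v, w}" "distinct [u, v, w]"
    using assms(2) by (auto simp: card_3_iff)
  define P :: "nat set set" where "P = (\<lambda>(b, c). {0, b, c}) ` ({3, 4, 5} \<times> {6, 7, 8})"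
  have "card P \<le> card ({3, 4, 5::nat} \<times> {6, 7, 8::nat})"
    unfolding P_def by (rule card_image_le) simp
  then have "card P \<le> 9" by (simp add: card_cartesian_product)
  obtain L where L: "list_assignment G 3 L" "L u = {0, 1, 2}" "L v = {3, 4, 5}" "L w = {6, 7, 8}"
    "\<And>f. proper_list_coloring G L f \<Longrightarrow> {f u, f v, f w} \<notin> P"
    by (rule blocking_assignment[OF U, of P "{0, 1, 2}" "{3, 4, 5}" "{6, 7, 8}"])
      (use \<open>card P \<le> 9\<close> assms(3) in \<open>auto simp: P_def\<close>)
  let ?r = "[u \<mapsto> 0::nat]"
  have "\<epsilon> * real (card (dom ?r)) \<le> real 0"
  proof (rule flexible_le[OF assms(1) L(1)])
    show "list_request G L ?r" using U L by (auto simp: list_request_def verts)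
    fix f assume f: "proper_list_coloring G L f"
    then have "(f v, f w) \<in> {3, 4, 5} \<times> {6, 7, 8}"
      using L(2-4) U(1) unfolding proper_list_coloring_def verts by blast
    then have "{0, f v, f w} \<in> P"
      unfolding P_def by (rule image_eqI[rotated]) simp
    then have "f u \<noteq> 0" using L(5)[OF f] by metis
    then have "{x \<in> dom ?r. ?r x = Some (f x)} = {}" by auto
    then show "card {x \<in> dom ?r. ?r x = Some (f x)} \<le> 0" by (simp only: card.empty)
  qed
  then show ?thesis by simp
qed

section \<open>The flexibility function as a maximum\<close>

text \<open>The supremum is attained: for fixed lists and request, a coloring that meets the most
  requests serves all flexible values at once, so its ratio bounds them and hence their
  supremum.\<close>

lemma greatest_flexible_exists:
  assumes "flexible G t s" "0 \<le> s" "s \<le> 1"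
  shows "\<exists>m. m \<in> {0..1} \<and> flexible G t m \<and> (\<forall>\<epsilon>. \<epsilon> \<in> {0..1} \<and> flexible G t \<epsilon> \<longrightarrow> \<epsilon> \<le> m)"
proof -
  define E where "E = {\<epsilon>. \<epsilon> \<in> {0..1} \<and> flexible G t \<epsilon>}"
  have s: "s \<in> E" using assms by (simp add: E_def)
  have bdd: "bdd_above E" by (rule bdd_aboveI[of _ 1]) (simp add: E_def)
  have "flexible G t (Sup E)"
    unfolding flexible_def
  proof (intro allI impI)
    fix L :: "'a \<Rightarrow> nat set" and r :: "'a \<rightharpoonup> nat"
    assume L: "list_assignment G t L" and r: "list_request G L r"
    have fin: "finite (dom r)" and "dom r \<noteq> {}"
      using r finite verts by (auto simp: list_request_def intro: finite_subset)
    then have pos: "real (card (dom r)) > 0" by (simp add: card_gt_0_iff)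
    let ?c = "\<lambda>f. card {v \<in> dom r. r v = Some (f v)}"
    have sat: "\<exists>f. proper_list_coloring G L f \<and> \<epsilon> * real (card (dom r)) \<le> real (?c f)" if "\<epsilon> \<in> E" for \<epsilon>
      using that L r unfolding E_def flexible_def satisfiable_request_def by blast
    obtain f0 where "proper_list_coloring G L f0" using sat[OF s] by blast
    moreover have "\<forall>f. proper_list_coloring G L f \<longrightarrow> ?c f < Suc (card (dom r))"
      using fin by (auto intro!: card_mono simp: less_Suc_eq_le)
    ultimately have "\<exists>f. proper_list_coloring G L f
        \<and> (\<forall>f'. proper_list_coloring G L f' \<longrightarrow> ?c f' \<le> ?c f)"
      by (rule ex_has_greatest_nat)
    then obtain f where f: "proper_list_coloring G L f"
      "\<And>f'. proper_list_coloring G L f' \<Longrightarrow> ?c f' \<le> ?c f" by blast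
    have "Sup E \<le> real (?c f) / real (card (dom r))"
    proof (rule cSup_least)
      fix \<epsilon> assume "\<epsilon> \<in> E"
      from sat[OF this] obtain f' where "proper_list_coloring G L f'"
        "\<epsilon> * real (card (dom r)) \<le> real (?c f')" by blast
      with f(2)[of f'] have "\<epsilon> * real (card (dom r)) \<le> real (?c f)" by linarith
      with pos show "\<epsilon> \<le> real (?c f) / real (card (dom r))" by (simp add: field_simps)
    qed (use s in blast)
    with pos have "Sup E * real (card (dom r)) \<le> real (?c f)" by (simp add: field_simps)
    with f(1) show "satisfiable_request (Sup E) G L r"
      unfolding satisfiable_request_def by blast
  qed
  moreover have "0 \<le> Sup E" using cSup_upper[OF s bdd] assms(2) by linarith
  moreover have "Sup E \<le> 1" using s by (intro cSup_least) (auto simp: E_def)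
  moreover have "\<forall>\<epsilon>. \<epsilon> \<in> {0..1} \<and> flexible G t \<epsilon> \<longrightarrow> \<epsilon> \<le> Sup E"
    using bdd by (auto intro!: cSup_upper simp: E_def)
  ultimately show ?thesis by (intro exI[of _ "Sup E"]) simp
qed

text \<open>A single flexible value \<open>s\<close> yields the domain condition, the existence of
  the maximum and the lower bound.\<close>

lemma list_epsilon_flexibility_bounds:
  assumes "flexible G t s" "0 \<le> s" "s \<le> 1" "t > 0"
    and upper: "\<And>\<epsilon>. flexible G t \<epsilon> \<Longrightarrow> \<epsilon> \<le> b"
  shows "s \<le> list_epsilon_flexibility G t" "list_epsilon_flexibility G t \<le> b"
proof -
  have "list_chromatic_number G \<le> t"
    unfolding list_chromatic_number_def
    using flexible_imp_choosable[OF assms(1,4)] by (intro Least_le) blast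
  then have eq: "list_epsilon_flexibility G t = (GREATEST \<epsilon>. \<epsilon> \<in> {0..1} \<and> flexible G t \<epsilon>)"
    by (simp add: list_epsilon_flexibility_def)
  obtain m where m: "m \<in> {0..1}" "flexible G t m"
    "\<And>\<epsilon>. \<epsilon> \<in> {0..1} \<and> flexible G t \<epsilon> \<Longrightarrow> \<epsilon> \<le> m"
    using greatest_flexible_exists[OF assms(1-3)] by blast
  have "list_epsilon_flexibility G t = m"
    unfolding eq using m by (intro Greatest_equality) blast+
  with m assms(1-3) upper show "s \<le> list_epsilon_flexibility G t" "list_epsilon_flexibility G t \<le> b"
    by auto
qed

end

theorem theorem8:
  fixes G :: "('a, 'b) pre_digraph" and n :: nat
  assumes "n \<ge> 3"
    and "complete_bipartite_digraph 3 n G"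
  shows "(\<forall>t \<ge> 4. list_epsilon_flexibility G t = 1 / 2)
    \<and> (n = 3 \<longrightarrow> list_epsilon_flexibility G 3 = 1 / 2)
    \<and> (4 \<le> n \<and> n \<le> 6 \<longrightarrow>
         1 / 3 \<le> list_epsilon_flexibility G 3 \<and> list_epsilon_flexibility G 3 \<le> 1 / 2)
    \<and> (7 \<le> n \<and> n \<le> 8 \<longrightarrow> list_epsilon_flexibility G 3 = 1 / 3)
    \<and> (9 \<le> n \<and> n \<le> 26 \<longrightarrow> list_epsilon_flexibility G 3 = 0)"
proof -
  from assms(2) obtain U V where UV: "verts G = U \<union> V" "U \<inter> V = {}" "card U = 3" "card V = n"
    "arcs_ends G = U \<times> V \<union> V \<times> U"
    unfolding complete_bipartite_digraph_def by blast
  \<comment> \<open>Positive cardinality makes both parts finite and nonempty.\<close>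
  interpret complete_bipartite_parts G U V
    using UV assms(1) by unfold_locales (auto intro: card_ge_0_finite)
  obtain u v w where U: "U = {u, v, w}" "distinct [u, v, w]"
    using UV(3) by (auto simp: card_3_iff)
  have mem: "u \<in> U" "v \<in> U" "w \<in> U" using U(1) by auto
  have card3: "card (L x) = 3" if "list_assignment G 3 L" "x \<in> U \<union> V" for L x
    using that by (simp add: list_assignment_def UV(1))
  have card_F: "card (L ` V) \<le> n" for L :: "'a \<Rightarrow> nat set"
    using card_image_le[OF finite(2)] UV(4) by metis
  have half: "list_epsilon_flexibility G t = 1 / 2" if "flexible G t (1 / 2)" "t > 0" for t
    using list_epsilon_flexibility_bounds[OF that(1) _ _ that(2) flexible_le_half[OF _ that(2)]]
    by (intro antisym) simp_all
  have third: "flexible G 3 (1 / 3)" if "n \<le> 8"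
  proof -
    have "flexible G 3 (1 / real 3)"
    proof (rule flexible_covered[OF U])
      fix L :: "'a \<Rightarrow> nat set" and r
      assume L: "list_assignment G 3 L" and r: "\<And>u. u \<in> U \<Longrightarrow> r u \<in> L u"
      show "covered (L ` V) (L u) (L v) (L w) (r u) (r v) (r w) 3"
        using card3[OF L] finite(2) card_F[of L] that r mem by (intro covered3) auto
    qed simp
    then show ?thesis by simp
  qed
  show ?thesis
  proof (intro conjI impI allI)
    fix t :: nat assume "4 \<le> t"
    then show "list_epsilon_flexibility G t = 1 / 2"
      using UV(3) by (intro half flexible_half_large_lists) auto
  next
    assume "n = 3"
    have "flexible G 3 (1 / real 2)"
    proof (rule flexible_covered[OF U])
      fix L :: "'a \<Rightarrow> nat set" and r
      assume L: "list_assignment G 3 L" and r: "\<And>u. u \<in> U \<Longrightarrow> r u \<in> L u"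
      show "covered (L ` V) (L u) (L v) (L w) (r u) (r v) (r w) 2"
        using card3[OF L] finite(2) card_F[of L] \<open>n = 3\<close> r mem by (intro covered2) auto
    qed simp
    then show "list_epsilon_flexibility G 3 = 1 / 2" by (intro half) simp_all
  next
    assume n: "4 \<le> n \<and> n \<le> 6"
    then have "flexible G 3 (1 / 3)" by (intro third) simp
    note bounds = list_epsilon_flexibility_bounds[OF this, of "1 / 2", OF _ _ _ flexible_le_half]
    show "1 / 3 \<le> list_epsilon_flexibility G 3" "list_epsilon_flexibility G 3 \<le> 1 / 2"
      using bounds by simp_all
  next
    assume n: "7 \<le> n \<and> n \<le> 8"
    then have "flexible G 3 (1 / 3)" by (intro third) simp
    note bounds = list_epsilon_flexibility_bounds[OF this, of "1 / 3", OF _ _ _ flexible_le_third]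
    show "list_epsilon_flexibility G 3 = 1 / 3"
      using bounds UV(3,4) n by (intro antisym) simp_all
  next
    assume n: "9 \<le> n \<and> n \<le> 26"
    \<comment> \<open>For the value 0 any proper list coloring will do.\<close>
    have "flexible G 3 0"
      unfolding flexible_def satisfiable_request_def
      using three_choosable UV(3,4) n by simp
    note bounds = list_epsilon_flexibility_bounds[OF this, of 0, OF _ _ _ flexible_le_zero]
    show "list_epsilon_flexibility G 3 = 0"
      using bounds UV(3,4) n by (intro antisym) simp_all
  qed
qed

end
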